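(* Let $\mathcal{H}$ be a nontrivial complex Hilbert space, let $A\in\mathcal{B}(\mathcal{H})$ be positive and nonzero, and let $T,S\in\mathcal{B}_A(\mathcal{H})$. Then the following statements are equivalent: (1) $T\parallel_A S$. (2) $r_A(S^{\sharp_A}T)=\|S^{\sharp_A}T\|_A=\|T^{\sharp_A}S\|_A=\|T\|_A\,\|S\|_A$. (3) $T^{\sharp_A}T\parallel_A T^{\sharp_A}S$ and $\|T^{\sharp_A}S\|_A=\|T\|_A\,\|S\|_A$. (4) $\|T^{\sharp_A}(T+\lambda S)\|_A=\|T\|_A(\|T\|_A+\|S\|_A)$ for some $\lambda\in\mathbb{C}$ with $|\lambda|=1$.
   Context: $\mathcal{B}(\mathcal{H})$ denotes the bounded linear operators on $\mathcal{H}$. Positive means $\langle Ax,x\rangle\ge 0$ for all $x$. Put $\langle x,y\rangle_A=\langle Ax,y\rangle$ and $\|x\|_A=\sqrt{\langle x,x\rangle_A}$. $\mathcal{B}_{A^{1/2}}(\mathcal{H})$ is the set of $A$-bounded operators, i.e. those $T\in\mathcal{B}(\mathcal{H})$ for which there is $c>0$ with $\|Tx\|_A\le c\|x\|_A$ for all $x\in\mathcal{H}$; for such $T$, $\|T\|_A=\sup\{\|Tx\|_A : x\in\mathcal{H},\ \|x\|_A=1\}$. $\mathcal{B}_A(\mathcal{H})=\{T\in\mathcal{B}(\mathcal{H}) : \mathcal{R}(T^*A)\subseteq\mathcal{R}(A)\}$ ($\mathcal{R}$ denotes range); one has $\mathcal{B}_A(\mathcal{H})\subseteq\mathcal{B}_{A^{1/2}}(\mathcal{H})$.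 For $T\in\mathcal{B}_A(\mathcal{H})$, $T^{\sharp_A}$ is the unique $X\in\mathcal{B}(\mathcal{H})$ with $AX=T^*A$ and $\mathcal{R}(X)\subseteq\overline{\mathcal{R}(A)}$. For $T,S\in\mathcal{B}_{A^{1/2}}(\mathcal{H})$, $T\parallel_A S$ ($A$-norm-parallel) means that there is $\lambda\in\mathbb{C}$ with $|\lambda|=1$ and $\|T+\lambda S\|_A=\|T\|_A+\|S\|_A$. The $A$-spectral radius of $T\in\mathcal{B}_{A^{1/2}}(\mathcal{H})$ is $r_A(T)=\inf_{n\ge1}\|T^n\|_A^{1/n}=\lim_{n\to\infty}\|T^n\|_A^{1/n}$. *)

theory Defs
  imports "HOL-Analysis.Analysis"
begin

text \<open>
  A complex Hilbert space is a complete inner product space over the complex numbers. The class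
  is built on the library's \<open>real_inner\<close>, whose inner product is required to be the real part of the
  complex one; the norm is therefore \<open>norm x = sqrt (Re (cinner x x))\<close>, and positive definiteness
  of \<open>cinner\<close> is inherited. The inner product is linear in the first argument.
\<close>

class complex_inner = real_inner +
  fixes scaleC :: "complex \<Rightarrow> 'a \<Rightarrow> 'a"  (infixr \<open>*\<^sub>C\<close> 75)
    and cinner :: "'a \<Rightarrow> 'a \<Rightarrow> complex"
  assumes scaleC_of_real: "complex_of_real r *\<^sub>C x = r *\<^sub>R x"
    and scaleC_add_right: "a *\<^sub>C (x + y) = a *\<^sub>C x + a *\<^sub>C y"
    and scaleC_add_left: "(a + b) *\<^sub>C x = a *\<^sub>C x + b *\<^sub>C x"
    and scaleC_scaleC: "a *\<^sub>C (b *\<^sub>C x) = (a * b) *\<^sub>C x"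
    and cinner_commute: "cinner x y = cnj (cinner y x)"
    and cinner_add_left: "cinner (x + y) z = cinner x z + cinner y z"
    and cinner_scaleC_left: "cinner (a *\<^sub>C x) y = a * cinner x y"
    and inner_eq_Re_cinner: "inner x y = Re (cinner x y)"

class complex_hilbert_space = complex_inner + complete_space

definition bounded_ops :: "('a::complex_hilbert_space \<Rightarrow> 'a) set" where
  "bounded_ops = {T. bounded_linear T \<and> (\<forall>c x. T (c *\<^sub>C x) = c *\<^sub>C T x)}"

definition cadjoint :: "('a::complex_hilbert_space \<Rightarrow> 'a) \<Rightarrow> ('a \<Rightarrow> 'a)" where
  "cadjoint T = (THE S. S \<in> bounded_ops \<and> (\<forall>x y. cinner (T x) y = cinner x (S y)))"

definition positive_op :: "('a::complex_hilbert_space \<Rightarrow> 'a) \<Rightarrow> bool" where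
  "positive_op A \<longleftrightarrow> A \<in> bounded_ops \<and> (\<forall>x. cinner (A x) x \<in> \<real> \<and> 0 \<le> Re (cinner (A x) x))"

definition A_cinner :: "('a::complex_hilbert_space \<Rightarrow> 'a) \<Rightarrow> 'a \<Rightarrow> 'a \<Rightarrow> complex" where
  "A_cinner A x y = cinner (A x) y"

definition A_norm :: "('a::complex_hilbert_space \<Rightarrow> 'a) \<Rightarrow> 'a \<Rightarrow> real" where
  "A_norm A x = sqrt (Re (A_cinner A x x))"

definition A_bounded_ops :: "('a::complex_hilbert_space \<Rightarrow> 'a) \<Rightarrow> ('a \<Rightarrow> 'a) set" where
  "A_bounded_ops A = {T \<in> bounded_ops. \<exists>c>0. \<forall>x. A_norm A (T x) \<le> c * A_norm A x}"

text \<open>The supremum is taken in the reals, so it is meaningful only if \<open>A \<noteq> 0\<close> (the set is then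
  nonempty) and \<open>T\<close> is \<open>A\<close>-bounded.\<close>

definition A_opnorm :: "('a::complex_hilbert_space \<Rightarrow> 'a) \<Rightarrow> ('a \<Rightarrow> 'a) \<Rightarrow> real" where
  "A_opnorm A T = Sup {A_norm A (T x) | x. A_norm A x = 1}"

text \<open>The operators \<open>T\<close> for which some bounded \<open>X\<close> satisfies \<open>A X = T\<^sup>* A\<close> (Douglas).\<close>

definition A_adjointable_ops :: "('a::complex_hilbert_space \<Rightarrow> 'a) \<Rightarrow> ('a \<Rightarrow> 'a) set" where
  "A_adjointable_ops A = {T \<in> bounded_ops. range (cadjoint T \<circ> A) \<subseteq> range A}"

definition A_sharp :: "('a::complex_hilbert_space \<Rightarrow> 'a) \<Rightarrow> ('a \<Rightarrow> 'a) \<Rightarrow> ('a \<Rightarrow> 'a)" where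
  "A_sharp A T =
     (THE X. X \<in> bounded_ops \<and> A \<circ> X = cadjoint T \<circ> A \<and> range X \<subseteq> closure (range A))"

definition A_parallel ::
  "('a::complex_hilbert_space \<Rightarrow> 'a) \<Rightarrow> ('a \<Rightarrow> 'a) \<Rightarrow> ('a \<Rightarrow> 'a) \<Rightarrow> bool" where
  "A_parallel A T S \<longleftrightarrow>
     T \<in> A_bounded_ops A \<and> S \<in> A_bounded_ops A \<and>
     (\<exists>c. cmod c = 1 \<and> A_opnorm A (\<lambda>x. T x + c *\<^sub>C S x) = A_opnorm A T + A_opnorm A S)"

definition A_spectral_radius ::
  "('a::complex_hilbert_space \<Rightarrow> 'a) \<Rightarrow> ('a \<Rightarrow> 'a) \<Rightarrow> real" where
  "A_spectral_radius A T = (INF n\<in>{1..}. root n (A_opnorm A (T ^^ n)))"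

end

theory Submission
  imports Defs
begin

text \<open>
  Write \<open>\<langle>x, y\<rangle> = ip x y\<close> and \<open>N\<close> for the semi-inner product and the seminorm given by \<open>A\<close>, and put
  \<open>t\<close>, \<open>s\<close> for the seminorms of \<open>T\<close>, \<open>S\<close>. For \<open>t, s > 0\<close>, parallelism of \<open>T\<close> and \<open>S\<close> means that for one
  unimodular \<open>c\<close> there are unit vectors \<open>x\<close> with \<open>Re (cnj c * \<langle>T x, S x\<rangle>)\<close> arbitrarily close to \<open>t s\<close>.
  As \<open>\<langle>T x, S x\<rangle> = \<langle>S\<^sup>\<sharp> T x, x\<rangle>\<close>, such vectors are approximate eigenvectors of \<open>U = S\<^sup>\<sharp> T\<close> for the
  eigenvalue \<open>t s c\<close>, which makes the spectral radius of \<open>U\<close> equal to its seminorm \<open>t s\<close>.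
  Conversely, if the spectral radius of \<open>U\<close> equals its seminorm \<open>M\<close>, then the seminorm of every power
  \<open>U\<^sup>n\<close> is \<open>M\<^sup>n\<close>, and repeated halving of the exponent \<open>n = 2\<^sup>m\<close> produces approximate eigenvectors
  with eigenvalues of modulus \<open>M\<close>; a limit of their phases gives \<open>c\<close>. The conditions on
  \<open>T\<^sup>\<sharp> (T + c S)\<close> follow from \<open>\<langle>T\<^sup>\<sharp> y, x\<rangle> = \<langle>y, T x\<rangle>\<close> and the fact that \<open>T\<^sup>\<sharp>\<close> has seminorm at most \<open>t\<close>.
\<close>

text \<open>\<open>M = UNIV\<close> is the Riesz theorem; \<open>f = inner z\<close> gives the orthogonal projection of \<open>z\<close> on \<open>M\<close>.\<close>

lemma closed_subspace_functional_representation: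
  fixes f :: "'a::{real_inner, complete_space} \<Rightarrow> real"
  assumes M: "closed M" "subspace M" and f: "bounded_linear f"
  shows "\<exists>p\<in>M. \<forall>y\<in>M. f y = inner p y"
proof -
  interpret f: bounded_linear f by (rule f)
  obtain K where K: "\<And>x. norm (f x) \<le> norm x * K" using f.bounded by blast
  define \<phi> where "\<phi> x = inner x x - 2 * f x" for x
  have lower: "\<phi> x \<ge> - K\<^sup>2" for x
  proof -
    have "f x \<le> norm x * K" using K[of x] by auto
    moreover have "0 \<le> (norm x - K)\<^sup>2" by simp
    ultimately show ?thesis
      unfolding \<phi>_def by (simp add: power2_diff dot_square_norm)
  qed
  define m where "m = (INF x\<in>M. \<phi> x)"
  have ne: "M \<noteq> {}" using subspace_0[OF M(2)] by auto
  have bdd: "bdd_below (\<phi> ` M)" using lower by (auto intro!: bdd_belowI)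
  have m_le: "m \<le> \<phi> x" if "x \<in> M" for x
    unfolding m_def using bdd that by (rule cINF_lower)
  have "\<exists>x\<in>M. \<phi> x < m + 1 / real (Suc n)" for n
    using cINF_less_iff[OF ne bdd, of "m + 1 / real (Suc n)"] by (simp add: m_def)
  then obtain X where X: "\<And>n. X n \<in> M" "\<And>n. \<phi> (X n) < m + 1 / real (Suc n)"
    by metis
  have para: "(dist x y)\<^sup>2 \<le> 2 * (\<phi> x + \<phi> y - 2 * m)" if "x \<in> M" "y \<in> M" for x y
  proof -
    have "(1/2) *\<^sub>R (x + y) \<in> M" using M(2) that by (simp add: subspace_add subspace_mul)
    from m_le[OF this] have "m \<le> (inner x x + 2 * inner x y + inner y y) / 4 - (f x + f y)"
      by (simp add: \<phi>_def f.add f.scaleR inner_add_left inner_add_right inner_commute field_simps)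
    moreover have "(dist x y)\<^sup>2 = inner x x - 2 * inner x y + inner y y"
      by (simp add: dist_norm power2_norm_eq_inner inner_diff_left inner_diff_right inner_commute)
    ultimately show ?thesis by (simp add: \<phi>_def field_simps)
  qed
  have "Cauchy X"
  proof (rule metric_CauchyI)
    fix e :: real assume "e > 0"
    then obtain n0 where n0: "1 / real (Suc n0) < e\<^sup>2 / 4"
      by (meson nat_approx_posE zero_less_divide_iff zero_less_numeral zero_less_power)
    show "\<exists>n0. \<forall>k\<ge>n0. \<forall>l\<ge>n0. dist (X k) (X l) < e"
    proof (intro exI allI impI)
      fix k l assume "k \<ge> n0" "l \<ge> n0"
      then have "1 / real (Suc k) \<le> 1 / real (Suc n0)" "1 / real (Suc l) \<le> 1 / real (Suc n0)"
        by (simp_all add: frac_le)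
      then have "(dist (X k) (X l))\<^sup>2 < e\<^sup>2"
        using para[OF X(1) X(1), of k l] X(2)[of k] X(2)[of l] n0 by argo
      then show "dist (X k) (X l) < e" using \<open>e > 0\<close> by (simp add: power_less_imp_less_base)
    qed
  qed
  then obtain p where p: "X \<longlonglongrightarrow> p" using Cauchy_convergent_iff convergent_def by blast
  have pM: "p \<in> M" using closed_sequentially[OF M(1) _ p] X(1) by blast
  have lim_phi: "(\<lambda>n. \<phi> (X n)) \<longlonglongrightarrow> \<phi> p"
    unfolding \<phi>_def by (intro tendsto_intros p f.tendsto)
  have "(\<lambda>n. m + 1 / real (Suc n)) \<longlonglongrightarrow> m + 0"
    by (intro tendsto_intros LIMSEQ_Suc lim_1_over_n)
  then have phi_p: "\<phi> p \<le> m"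
    using X(2) by (intro LIMSEQ_le[OF lim_phi]) (auto intro: less_imp_le)
  have "f y = inner p y" if "y \<in> M" for y
  proof -
    define d where "d = inner p y - f y"
    define N where "N = inner y y + 1"
    have N: "N > 0" unfolding N_def by (simp add: add_nonneg_pos)
    define r where "r = - d / N"
    have "p + r *\<^sub>R y \<in> M" using M(2) pM that by (simp add: subspace_add subspace_mul)
    from m_le[OF this] phi_p have "\<phi> p \<le> \<phi> (p + r *\<^sub>R y)" by linarith
    then have "0 \<le> 2 * r * d + r\<^sup>2 * inner y y"
      by (simp add: \<phi>_def d_def f.add f.scaleR inner_add_left inner_add_right inner_commute
          algebra_simps power2_eq_square)
    also have "\<dots> \<le> 2 * r * d + r\<^sup>2 * N" by (simp add: N_def mult_left_mono)
    also have "\<dots> = - (d\<^sup>2 / N)" using N by (simp add: r_def field_simps power2_eq_square)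
    finally have "d\<^sup>2 \<le> 0" using N by (simp add: divide_le_0_iff)
    then show ?thesis by (simp add: d_def)
  qed
  then show ?thesis using pM by blast
qed

section \<open>Complex inner products and Hilbert space adjoints\<close>

lemma cinner_add_right: "cinner x (y + z) = cinner x y + cinner (x::'a::complex_inner) z"
  using cinner_add_left[of y z x] cinner_commute by (metis complex_cnj_add)

lemma cinner_scaleC_right: "cinner x (a *\<^sub>C y) = cnj a * cinner (x::'a::complex_inner) y"
  by (metis cinner_commute cinner_scaleC_left complex_cnj_mult)

lemma cinner_scaleR_left: "cinner (r *\<^sub>R x) y = complex_of_real r * cinner (x::'a::complex_inner) y"
  by (metis cinner_scaleC_left scaleC_of_real)

lemma cinner_minus_left: "cinner (- x) y = - cinner (x::'a::complex_inner) y"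
  using cinner_scaleR_left[of "-1" x y] by simp

lemma cinner_diff_left: "cinner (x - y) z = cinner x z - cinner (y::'a::complex_inner) z"
  using cinner_add_left[of x "- y" z] by (simp add: cinner_minus_left)

lemma cinner_diff_right: "cinner x (y - z) = cinner x y - cinner (x::'a::complex_inner) z"
  by (metis cinner_commute cinner_diff_left complex_cnj_diff)

text \<open>Multiplying \<open>x\<close> by \<open>\<i>\<close> turns the imaginary part into a real
  one, so identities of real inner products lift to \<open>cinner\<close>.\<close>

lemma cinner_eq_inner:
  "cinner x y = Complex (inner x y) (- inner (\<i> *\<^sub>C x) (y::'a::complex_inner))"
  by (simp add: complex_eq_iff inner_eq_Re_cinner cinner_scaleC_left)

lemma scaleC_diff_right: "a *\<^sub>C (x - y) = a *\<^sub>C x - a *\<^sub>C (y::'a::complex_inner)"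
  using scaleC_add_right[of a "x - y" y] by (simp add: eq_diff_eq)

lemma norm_scaleC: "norm (a *\<^sub>C x) = cmod a * norm (x::'a::complex_inner)"
proof -
  have "inner (a *\<^sub>C x) (a *\<^sub>C x) = Re ((a * cnj a) * cinner x x)"
    by (simp add: inner_eq_Re_cinner cinner_scaleC_left cinner_scaleC_right algebra_simps)
  also have "\<dots> = (cmod a)\<^sup>2 * inner x x"
    by (simp add: complex_norm_square[symmetric] inner_eq_Re_cinner del: of_real_power)
  finally show ?thesis
    by (simp add: norm_eq_sqrt_inner real_sqrt_mult)
qed

text \<open>A unimodular factor on \<open>x\<close> makes the product real and nonnegative, which
  reduces the bound to the real Cauchy-Schwarz inequality.\<close>

lemma cmod_cinner_le: "cmod (cinner x y) \<le> norm x * norm (y::'a::complex_inner)"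
proof (cases "cinner x y = 0")
  case False
  define a where "a = cnj (sgn (cinner x y))"
  have a: "cmod a = 1" using False by (simp add: a_def norm_sgn)
  have "a * cinner x y = of_real (cmod (cinner x y))"
    using False by (simp add: a_def sgn_eq field_simps complex_norm_square[symmetric])
       (simp add: power2_eq_square)
  then have "cmod (cinner x y) = inner (a *\<^sub>C x) y"
    by (simp add: inner_eq_Re_cinner cinner_scaleC_left)
  also have "\<dots> \<le> norm (a *\<^sub>C x) * norm y" by (rule norm_cauchy_schwarz)
  finally show ?thesis using a by (simp add: norm_scaleC)
qed simp

lemma bounded_opsD:
  assumes "T \<in> bounded_ops"
  shows "bounded_linear T" "T (c *\<^sub>C x) = c *\<^sub>C T x" "T (x + y) = T x + T y" "T (x - y) = T x - T y"
  using assms unfolding bounded_ops_def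
  by (auto simp: bounded_linear.linear linear_add linear_diff)

lemma bounded_ops_comp: "T \<in> bounded_ops \<Longrightarrow> S \<in> bounded_ops \<Longrightarrow> T \<circ> S \<in> bounded_ops"
  unfolding bounded_ops_def by (auto simp: o_def intro: bounded_linear_compose)

lemma bounded_ops_add_scaleC:
  assumes "T \<in> bounded_ops" "S \<in> bounded_ops"
  shows "(\<lambda>x. T x + c *\<^sub>C S x) \<in> bounded_ops"
proof -
  have "bounded_linear (\<lambda>x::'a. c *\<^sub>C x)"
    by (rule bounded_linear_intro[where K = "cmod c"])
      (auto simp: scaleC_add_right norm_scaleC scaleC_scaleC scaleC_of_real[symmetric] mult.commute)
  then have "bounded_linear (\<lambda>x. T x + c *\<^sub>C S x)"
    using bounded_linear_add bounded_linear_compose assms by (metis bounded_opsD(1))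
  then show ?thesis using assms
    by (auto simp: bounded_ops_def scaleC_add_right scaleC_scaleC mult.commute)
qed

lemma cinner_left_cong:
  fixes T :: "'a::complex_hilbert_space \<Rightarrow> 'a"
  assumes T: "T \<in> bounded_ops" and eq: "\<And>x. inner (T x) y = inner x z"
  shows "cinner (T x) y = cinner x z"
  using eq[of x] eq[of "\<i> *\<^sub>C x"] by (simp add: cinner_eq_inner bounded_opsD[OF T])

lemma cinner_ext_right: "(\<And>x. cinner x y = cinner x z) \<Longrightarrow> y = (z::'a::complex_inner)"
  by (metis inner_eq_Re_cinner inner_commute vector_eq_ldot vector_eq_rdot)

lemma cinner_ext_left: "(\<And>x. cinner y x = cinner z x) \<Longrightarrow> y = (z::'a::complex_inner)"
  by (metis cinner_commute cinner_ext_right)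

text \<open>Riesz representation of the real functional \<open>inner (T x) y\<close> gives
  \<open>S y\<close>. Linearity of \<open>S\<close> holds because \<open>cinner\<close> separates
  vectors; its bound comes from pairing \<open>S x\<close> with itself.\<close>

lemma cadjoint_exists:
  assumes T: "T \<in> bounded_ops"
  shows "\<exists>S. S \<in> bounded_ops \<and> (\<forall>x y. cinner (T x) y = cinner x (S y))"
proof -
  have "\<exists>p. \<forall>x. inner (T x) y = inner p x" for y
    using closed_subspace_functional_representation[of UNIV "\<lambda>x. inner (T x) y"]
      bounded_linear_compose[OF bounded_linear_inner_left bounded_opsD(1)[OF T]] by auto
  then obtain S where S: "\<And>x y. inner (T x) y = inner x (S y)"
    by (metis inner_commute)
  then have cS: "cinner (T x) y = cinner x (S y)" for x y
    using cinner_left_cong[OF T] by blast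
  obtain K where K: "\<And>x. norm (T x) \<le> norm x * K" "K > 0"
    using bounded_linear.pos_bounded[OF bounded_opsD(1)[OF T]] by blast
  have scale: "S (c *\<^sub>C x) = c *\<^sub>C S x" for c x
    by (rule cinner_ext_right) (simp add: cS[symmetric] cinner_scaleC_right)
  have "bounded_linear S"
  proof (rule bounded_linear_intro[where K = K])
    show "S (x + y) = S x + S y" for x y
      by (rule cinner_ext_right) (simp add: cS[symmetric] cinner_add_right)
    show "S (r *\<^sub>R x) = r *\<^sub>R S x" for r x
      using scale[of "of_real r" x] by (simp add: scaleC_of_real)
    show "norm (S x) \<le> norm x * K" for x
    proof (cases "S x = 0")
      case False
      have "norm (S x) * norm (S x) = inner (T (S x)) x"
        by (simp add: S norm_eq_sqrt_inner)
      also have "\<dots> \<le> norm (T (S x)) * norm x" by (rule norm_cauchy_schwarz)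
      also have "\<dots> \<le> (norm (S x) * K) * norm x" by (intro mult_right_mono K) simp
      finally show ?thesis using False by (simp add: mult.assoc mult.commute)
    qed (use K in simp)
  qed
  then show ?thesis using scale cS by (auto simp: bounded_ops_def)
qed

lemma cinner_cadjoint:
  assumes "T \<in> bounded_ops"
  shows "cinner (T x) y = cinner x (cadjoint T y)"
proof -
  have "\<exists>!S. S \<in> bounded_ops \<and> (\<forall>x y. cinner (T x) y = cinner x (S y))"
  proof (rule ex_ex1I)
    fix S S' assume "S \<in> bounded_ops \<and> (\<forall>x y. cinner (T x) y = cinner x (S y))"
      and "S' \<in> bounded_ops \<and> (\<forall>x y. cinner (T x) y = cinner x (S' y))"
    then have "S y = S' y" for y by (intro cinner_ext_right) metis
    then show "S = S'" by blast
  qed (rule cadjoint_exists[OF assms])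
  from theI'[OF this] show ?thesis unfolding cadjoint_def by blast
qed

subsection \<open>The semi-inner product of a positive operator\<close>

locale positive_operator =
  fixes A :: "'a::complex_hilbert_space \<Rightarrow> 'a"
  assumes pos: "positive_op A"
begin

abbreviation ip :: "'a \<Rightarrow> 'a \<Rightarrow> complex" where "ip \<equiv> A_cinner A"
abbreviation N :: "'a \<Rightarrow> real" where "N \<equiv> A_norm A"

lemma A_in_bounded_ops: "A \<in> bounded_ops"
  using pos by (simp add: positive_op_def)

lemma bounded_linear_A: "bounded_linear A"
  by (rule bounded_opsD[OF A_in_bounded_ops])

lemma ip_self: "Im (ip x x) = 0" "0 \<le> Re (ip x x)"
  using pos by (auto simp: positive_op_def A_cinner_def complex_is_Real_iff)

lemma ip_add_left: "ip (x + y) z = ip x z + ip y z"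
  and ip_diff_left: "ip (x - y) z = ip x z - ip y z"
  and ip_scaleC_left: "ip (a *\<^sub>C x) z = a * ip x z"
  and ip_add_right: "ip z (x + y) = ip z x + ip z y"
  and ip_diff_right: "ip z (x - y) = ip z x - ip z y"
  and ip_scaleC_right: "ip z (a *\<^sub>C x) = cnj a * ip z x"
  by (simp_all add: A_cinner_def bounded_opsD[OF A_in_bounded_ops] cinner_add_left
      cinner_diff_left cinner_scaleC_left cinner_add_right cinner_diff_right cinner_scaleC_right)

lemmas ip_simps = ip_add_left ip_diff_left ip_scaleC_left ip_add_right ip_diff_right ip_scaleC_right

lemma ip_scaleR: "ip (r *\<^sub>R x) y = of_real r * ip x y" "ip y (r *\<^sub>R x) = of_real r * ip y x"
  by (simp_all add: ip_scaleC_left ip_scaleC_right flip: scaleC_of_real)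

text \<open>Polarization: diagonal values of \<open>ip\<close> are real, and this is applied to
  \<open>x + y\<close> and to \<open>x + \<i> *\<^sub>C y\<close>.\<close>

lemma ip_commute: "ip x y = cnj (ip y x)"
proof -
  have "Im (ip y x + ip x y) = 0"
    using ip_self(1)[of "x + y"] ip_self(1)[of x] ip_self(1)[of y] by (simp add: ip_simps)
  moreover have "Re (ip y x) - Re (ip x y) = 0"
    using ip_self(1)[of "x + \<i> *\<^sub>C y"] ip_self(1)[of x] ip_self(1)[of y] by (simp add: ip_simps)
  ultimately show ?thesis by (simp add: complex_eq_iff)
qed

lemma A_selfadjoint: "cinner (A x) y = cinner x (A y)"
  using ip_commute[of x y] by (metis A_cinner_def cinner_commute)

lemma N_nonneg: "0 \<le> N x"
  by (simp add: A_norm_def ip_self)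

lemma N_square: "(N x)\<^sup>2 = Re (ip x x)"
  by (simp add: A_norm_def ip_self)

lemma N_scaleC: "N (a *\<^sub>C x) = cmod a * N x"
proof -
  have "(N (a *\<^sub>C x))\<^sup>2 = Re ((a * cnj a) * ip x x)"
    by (simp add: N_square ip_simps algebra_simps)
  also have "\<dots> = (cmod a * N x)\<^sup>2"
    by (simp add: complex_norm_square[symmetric] N_square power_mult_distrib del: of_real_power)
  finally show ?thesis by (simp add: N_nonneg)
qed

lemma N_scaleR: "N (r *\<^sub>R x) = \<bar>r\<bar> * N x"
  using N_scaleC[of "of_real r" x] by (simp add: scaleC_of_real)

lemma N_add_square: "(N (x + y))\<^sup>2 = (N x)\<^sup>2 + (N y)\<^sup>2 + 2 * Re (ip x y)"
  using ip_commute[of x y] by (simp add: N_square ip_simps)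

lemma N_diff_square: "(N (x - y))\<^sup>2 = (N x)\<^sup>2 + (N y)\<^sup>2 - 2 * Re (ip x y)"
  using ip_commute[of x y] by (simp add: N_square ip_simps)

lemma Cauchy_Schwarz_Re: "Re (ip x y) \<le> N x * N y"
proof (cases "N x = 0 \<or> N y = 0")
  case False
  then have *: "N x > 0" "N y > 0" using N_nonneg by (auto simp: less_le)
  have "0 \<le> (N (N y *\<^sub>R x - N x *\<^sub>R y))\<^sup>2" by simp
  also have "\<dots> = 2 * (N x * N y) * (N x * N y - Re (ip x y))"
    unfolding N_diff_square
    by (simp add: N_scaleR ip_scaleR N_nonneg power2_eq_square algebra_simps)
  finally have "0 \<le> 2 * (N x * N y) * (N x * N y - Re (ip x y))" .
  moreover have "0 < 2 * (N x * N y)" using * by simp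
  ultimately show ?thesis by (simp only: zero_le_mult_iff) linarith
next
  case True
  define w where "w = Re (ip x y)"
  \<comment> \<open>\<open>N\<close> may vanish on nonzero vectors. Scaling such a vector by
    \<open>r\<close> costs nothing on the right, while the left side grows linearly in
    \<open>r\<close> if \<open>w > 0\<close>.\<close>
  have q: "2 * (r * w) \<le> (N x)\<^sup>2 + r\<^sup>2 * (N y)\<^sup>2" "2 * (r * w) \<le> r\<^sup>2 * (N x)\<^sup>2 + (N y)\<^sup>2" for r
    using N_diff_square[of x "of_real r *\<^sub>C y"] N_diff_square[of "of_real r *\<^sub>C x" y]
      zero_le_power2[of "N (x - of_real r *\<^sub>C y)"] zero_le_power2[of "N (of_real r *\<^sub>C x - y)"]
    by (simp_all add: N_scaleC ip_simps w_def power_mult_distrib)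
  have "w \<le> 0"
  proof (rule ccontr)
    assume "\<not> w \<le> 0"
    then have w: "w > 0" by simp
    define r where "r = ((N x)\<^sup>2 + (N y)\<^sup>2 + 1) / w"
    have "2 * (r * w) = 2 * ((N x)\<^sup>2 + (N y)\<^sup>2 + 1)" using w by (simp add: r_def)
    moreover have "r\<^sup>2 * (N x)\<^sup>2 = 0 \<or> r\<^sup>2 * (N y)\<^sup>2 = 0" using True by auto
    ultimately show False using q[of r] zero_le_power2[of "N x"] zero_le_power2[of "N y"]
      by argo
  qed
  then show ?thesis using True by (auto simp: w_def)
qed

lemma N_triangle: "N (x + y) \<le> N x + N y"
proof (rule power2_le_imp_le)
  show "(N (x + y))\<^sup>2 \<le> (N x + N y)\<^sup>2"
    using Cauchy_Schwarz_Re[of x y] by (simp add: N_add_square power2_sum)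
qed (simp add: N_nonneg)

lemma N_le_norm: "\<exists>K>0. \<forall>x. N x \<le> K * norm x"
proof -
  obtain K where K: "\<And>x. norm (A x) \<le> norm x * K" "K > 0"
    using bounded_linear.pos_bounded[OF bounded_linear_A] by blast
  have "N x \<le> sqrt K * norm x" for x
  proof (rule power2_le_imp_le)
    have "(N x)\<^sup>2 \<le> cmod (cinner (A x) x)"
      unfolding N_square A_cinner_def by (rule complex_Re_le_cmod)
    also have "\<dots> \<le> norm (A x) * norm x" by (rule cmod_cinner_le)
    also have "\<dots> \<le> (norm x * K) * norm x" by (intro mult_right_mono K) simp
    also have "\<dots> = (sqrt K * norm x)\<^sup>2" using K(2) by (simp add: power_mult_distrib power2_eq_square)
    finally show "(N x)\<^sup>2 \<le> (sqrt K * norm x)\<^sup>2" .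
  qed (use K(2) in simp)
  then show ?thesis using K(2) by (intro exI[of _ "sqrt K"]) auto
qed

text \<open>By Cauchy-Schwarz a vector of seminorm 0 is \<open>ip\<close>-orthogonal to every
  vector.\<close>

lemma A_eq_0_of_N: "N x = 0 \<Longrightarrow> A x = 0"
proof (rule cinner_ext_left)
  fix y
  assume x: "N x = 0"
  have Re0: "Re (ip x z) = 0" for z
    using Cauchy_Schwarz_Re[of x z] Cauchy_Schwarz_Re[of x "- 1 *\<^sub>C z"] x
    by (simp add: ip_simps)
  have "Im (ip x y) = 0" using Re0[of "\<i> *\<^sub>C y"] by (simp add: ip_simps)
  then show "cinner (A x) y = cinner 0 y"
    using Re0[of y] cinner_diff_left[of 0 0 y] by (simp add: A_cinner_def complex_eq_iff)
qed

subsection \<open>The range of \<open>A\<close> and the operator \<open>A_sharp\<close>\<close>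

lemma inner_A: "inner (A x) y = inner x (A y)"
  using A_selfadjoint by (simp add: inner_eq_Re_cinner)

lemma subspace_closure_range_A: "subspace (closure (range A))"
proof -
  interpret A: bounded_linear A by (rule bounded_linear_A)
  show ?thesis
  proof (rule subspaceI)
    show "0 \<in> closure (range A)"
      using closure_subset A.zero by (metis range_eqI subsetD)
  next
    fix x y assume "x \<in> closure (range A)" "y \<in> closure (range A)"
    then obtain f g where f: "\<And>n. f n \<in> range A" "f \<longlonglongrightarrow> x" and g: "\<And>n. g n \<in> range A" "g \<longlonglongrightarrow> y"
      unfolding closure_sequential by blast
    have "f n + g n \<in> range A" for n
      using f(1)[of n] g(1)[of n] A.add by (metis (no_types, opaque_lifting) rangeE rangeI)
    then show "x + y \<in> closure (range A)"
      unfolding closure_sequential using tendsto_add[OF f(2) g(2)]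
      by (intro exI[of _ "\<lambda>n. f n + g n"]) simp
  next
    fix c x assume "x \<in> closure (range A)"
    then obtain f where f: "\<And>n. f n \<in> range A" "f \<longlonglongrightarrow> x"
      unfolding closure_sequential by blast
    have "c *\<^sub>R f n \<in> range A" for n
      using f(1)[of n] A.scaleR by (metis (no_types, opaque_lifting) rangeE rangeI)
    then show "c *\<^sub>R x \<in> closure (range A)"
      unfolding closure_sequential using tendsto_scaleR[OF tendsto_const f(2)]
      by (intro exI[of _ "\<lambda>n. c *\<^sub>R f n"]) simp
  qed
qed

text \<open>\<open>p\<close> is the orthogonal projection of \<open>z\<close> on the closure of the
  range; \<open>z - p\<close> is orthogonal to \<open>range A\<close>, hence in the kernel of the
  symmetric operator \<open>A\<close>.\<close>

lemma closure_range_A_preimage: "\<exists>p\<in>closure (range A). A p = A z"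
proof -
  obtain p where p: "p \<in> closure (range A)" "\<And>y. y \<in> closure (range A) \<Longrightarrow> inner z y = inner p y"
    using closed_subspace_functional_representation[of "closure (range A)" "inner z"]
      bounded_linear_inner_right subspace_closure_range_A by auto
  have "inner (A p) u = inner (A z) u" for u
    using p(2)[of "A u"] closure_subset[of "range A"] by (simp add: inner_A subset_iff)
  then have "A p = A z" using vector_eq_rdot by blast
  with p show ?thesis by blast
qed

text \<open>The inequality passes from \<open>range A\<close> to its closure by continuity and is
  then applied to \<open>p\<close> itself.\<close>

lemma closure_range_A_test:
  assumes p: "p \<in> closure (range A)" and "0 \<le> C" and C: "\<And>z. inner p (A z) \<le> C * norm (A z)"
  shows "norm p \<le> C"
proof -
  have cl: "closed {y. inner p y \<le> C * norm y}"
    by (intro closed_Collect_le continuous_intros)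
  have "closure (range A) \<subseteq> {y. inner p y \<le> C * norm y}"
    by (rule closure_minimal[OF _ cl]) (use C in auto)
  with p have "inner p p \<le> C * norm p" by blast
  then have "norm p * norm p \<le> C * norm p" by (simp add: norm_eq_sqrt_inner)
  then show ?thesis using \<open>0 \<le> C\<close> by (cases "norm p = 0") auto
qed

text \<open>The kernel of \<open>A\<close> is orthogonal to its range. This gives the uniqueness of
  \<open>A_sharp\<close> and the linearity of pointwise chosen solutions.\<close>

lemma closure_range_A_eqI:
  assumes "p \<in> closure (range A)" "q \<in> closure (range A)" "A p = A q"
  shows "p = q"
proof -
  have "p - q \<in> closure (range A)"
    using assms subspace_closure_range_A by (simp add: subspace_diff)
  moreover have "inner (p - q) (A z) = 0" for z
    using assms(3) by (simp add: inner_A[symmetric] bounded_opsD[OF A_in_bounded_ops])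
  ultimately have "norm (p - q) \<le> 0" by (intro closure_range_A_test) auto
  then show ?thesis by simp
qed

text \<open>\<open>subspace\<close> covers real scalars only; complex ones are applied to an
  approximating sequence.\<close>

lemma closure_range_A_scaleC:
  assumes p: "p \<in> closure (range A)"
  shows "c *\<^sub>C p \<in> closure (range A)"
proof -
  obtain f where f: "\<And>n. f n \<in> range A" "f \<longlonglongrightarrow> p"
    using p unfolding closure_sequential by blast
  have "c *\<^sub>C f n \<in> range A" for n
  proof -
    obtain z where "f n = A z" using f(1)[of n] by blast
    then have "c *\<^sub>C f n = A (c *\<^sub>C z)" by (simp add: bounded_opsD(2)[OF A_in_bounded_ops])
    then show ?thesis by simp
  qed
  moreover have "(\<lambda>n. c *\<^sub>C f n) \<longlonglongrightarrow> c *\<^sub>C p"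
  proof (rule tendstoI)
    fix e :: real assume "e > 0"
    then have "\<forall>\<^sub>F n in sequentially. dist (f n) p < e / (cmod c + 1)"
      by (intro tendstoD[OF f(2)]) (simp add: add_nonneg_pos)
    then show "\<forall>\<^sub>F n in sequentially. dist (c *\<^sub>C f n) (c *\<^sub>C p) < e"
    proof eventually_elim
      case (elim n)
      have "dist (c *\<^sub>C f n) (c *\<^sub>C p) = cmod c * dist (f n) p"
        using scaleC_add_right[of c "f n - p" p] by (simp add: dist_norm norm_scaleC[symmetric])
      also have "\<dots> \<le> (cmod c + 1) * dist (f n) p" by (simp add: mult_right_mono)
      also have "\<dots> < e" using elim by (simp add: pos_less_divide_eq add_nonneg_pos mult.commute)
      finally show ?case .
    qed
  qed
  ultimately show ?thesis
    unfolding closure_sequential by (intro exI[of _ "\<lambda>n. c *\<^sub>C f n"]) simp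
qed

text \<open>The pointwise solution \<open>X\<close> of \<open>A X = T\<^sup>* A\<close> is bounded because the functionals
  \<open>x \<mapsto> \<langle>X x, A z\<rangle> = \<langle>x, A T z\<rangle>\<close> with \<open>norm (A z) \<le> 1\<close> are continuous and pointwise bounded.\<close>

lemma Douglas_bounded:
  assumes T: "T \<in> bounded_ops"
    and X: "\<And>x. X x \<in> closure (range A)" "\<And>x z. inner (X x) (A z) = inner x (A (T z))"
  shows "\<exists>K. \<forall>x. norm (X x) \<le> norm x * K"
proof -
  define E where "E n = {x. \<forall>z. norm (A z) \<le> 1 \<longrightarrow> \<bar>inner x (A (T z))\<bar> \<le> real n}" for n
  have bound_X: "\<bar>inner x (A (T z))\<bar> \<le> norm (X x)" if "norm (A z) \<le> 1" for x z
  proof -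
    have "\<bar>inner x (A (T z))\<bar> \<le> norm (X x) * norm (A z)"
      unfolding X(2)[symmetric] by (rule Cauchy_Schwarz_ineq2)
    also have "\<dots> \<le> norm (X x) * 1" by (intro mult_left_mono that) simp
    finally show ?thesis by simp
  qed
  have "closed (E n)" for n
    unfolding E_def by (intro closed_Collect_all closed_Collect_imp closed_Collect_le
        continuous_intros open_Collect_const)
  moreover have "x \<in> (\<Union>n. E n)" for x
  proof -
    obtain n where "norm (X x) \<le> real n" using real_arch_simple by blast
    then have "x \<in> E n" using bound_X[of _ x] unfolding E_def by (auto intro: order_trans)
    then show ?thesis by blast
  qed
  then have "(\<Union>n. E n) = UNIV" by blast
  \<comment> \<open>By Baire's theorem one of the closed sets \<open>E n\<close> has an interior
    point, which turns the pointwise bound into a uniform one on a ball.\<close>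
  ultimately have "\<exists>n. interior (E n) \<noteq> {}"
    using Baire_category_alt[of "euclidean :: 'a topology" "range E"]
    by (auto simp: completely_metrizable_space_euclidean)
  then obtain n x0 where "x0 \<in> interior (E n)" by blast
  then obtain r where r: "r > 0" "ball x0 r \<subseteq> E n" by (meson mem_interior)
  \<comment> \<open>\<open>h\<close> is the difference of the points \<open>x0 + h\<close> and
    \<open>x0\<close> of \<open>E n\<close>, hence the factor 2.\<close>
  have small: "inner h (A (T z)) \<le> 2 * real n" if "norm h < r" "norm (A z) \<le> 1" for h z
  proof -
    have "x0 + h \<in> E n" "x0 \<in> E n" using r that by (auto simp: dist_norm subset_iff)
    then have "\<bar>inner (x0 + h) (A (T z))\<bar> \<le> n" "\<bar>inner x0 (A (T z))\<bar> \<le> n"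
      using that(2) by (auto simp: E_def)
    then show ?thesis by (simp add: inner_add_left)
  qed
  \<comment> \<open>Below, a nonzero \<open>x\<close> is scaled to norm \<open>r / 2\<close> so that
    \<open>small\<close> applies; undoing this multiplies the bound \<open>2 * n\<close> by
    \<open>2 / r\<close>.\<close>
  define K where "K = 4 * real n / r"
  have "norm (X x) \<le> norm x * K" for x
  proof (cases "x = 0")
    case True
    have "norm (X 0) \<le> 0" by (intro closure_range_A_test X(1)) (simp_all add: X(2))
    with True show ?thesis by simp
  next
    case False
    show ?thesis
    proof (rule closure_range_A_test[OF X(1)])
      show "0 \<le> norm x * K" using r by (simp add: K_def)
      fix z
      show "inner (X x) (A z) \<le> (norm x * K) * norm (A z)"
      proof (cases "A z = 0")
        case False
        interpret A: bounded_linear A by (rule bounded_linear_A)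
        interpret T: bounded_linear T by (rule bounded_opsD(1)[OF T])
        have "inner ((r / (2 * norm x)) *\<^sub>R x) (A (T ((1 / norm (A z)) *\<^sub>R z))) \<le> 2 * real n"
          by (rule small) (use False \<open>x \<noteq> 0\<close> r in \<open>auto simp: A.scaleR\<close>)
        then have "r / (2 * norm x) * (1 / norm (A z)) * inner x (A (T z)) \<le> 2 * real n"
          by (simp add: T.scaleR A.scaleR mult_ac)
        then show ?thesis
          using False \<open>x \<noteq> 0\<close> r by (simp add: X(2) K_def divide_simps mult_ac)
      qed simp
    qed
  qed
  then show ?thesis by blast
qed

text \<open>Solutions are chosen pointwise in the closure of the range, where they are unique.
  Uniqueness makes the choice linear, and \<open>Douglas_bounded\<close> makes it
  continuous.\<close>

lemma A_sharp_exists: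
  assumes T: "T \<in> A_adjointable_ops A"
  shows "\<exists>X. X \<in> bounded_ops \<and> A \<circ> X = cadjoint T \<circ> A \<and> range X \<subseteq> closure (range A)"
proof -
  have Tb: "T \<in> bounded_ops" and ran: "range (cadjoint T \<circ> A) \<subseteq> range A"
    using T by (auto simp: A_adjointable_ops_def)
  have "\<exists>p. p \<in> closure (range A) \<and> A p = cadjoint T (A x)" for x
  proof -
    have "cadjoint T (A x) \<in> range A" using ran by auto
    then obtain z where "cadjoint T (A x) = A z" by blast
    then show ?thesis using closure_range_A_preimage[of z] by auto
  qed
  then obtain X where X: "\<And>x. X x \<in> closure (range A)" "\<And>x. A (X x) = cadjoint T (A x)" by metis
  have ipX: "cinner (A (X x)) z = cinner x (A (T z))" for x z
    unfolding X(2) using cinner_cadjoint[OF Tb, of z "A x"] A_selfadjoint[of x "T z"]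
    by (metis cinner_commute)
  then have inX: "inner (X x) (A z) = inner x (A (T z))" for x z
    by (simp add: inner_A[symmetric] inner_eq_Re_cinner)
      (metis A_selfadjoint)
  obtain K where K: "\<And>x. norm (X x) \<le> norm x * K"
    using Douglas_bounded[OF Tb X(1) inX] by blast
  note AD = bounded_opsD[OF A_in_bounded_ops]
  have scaleC: "X (c *\<^sub>C x) = c *\<^sub>C X x" for c x
    by (rule closure_range_A_eqI[OF X(1) closure_range_A_scaleC[OF X(1)]], rule cinner_ext_left)
      (simp add: AD cinner_scaleC_left ipX)
  have add: "X (x + y) = X x + X y" for x y
    by (rule closure_range_A_eqI[OF X(1) subspace_add[OF subspace_closure_range_A X(1) X(1)]],
        rule cinner_ext_left)
      (simp add: AD cinner_add_left ipX)
  have "bounded_linear X"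
  proof (rule bounded_linear_intro[where K = K])
    show "X (r *\<^sub>R x) = r *\<^sub>R X x" for r x
      using scaleC[of "of_real r" x] by (simp add: scaleC_of_real)
  qed (use add K in auto)
  then have "X \<in> bounded_ops" using scaleC by (simp add: bounded_ops_def)
  then show ?thesis using X by (intro exI[of _ X]) auto
qed

lemma A_sharp:
  assumes T: "T \<in> A_adjointable_ops A"
  shows A_sharp_bounded: "A_sharp A T \<in> bounded_ops"
    and ip_A_sharp: "ip (A_sharp A T x) y = ip x (T y)"
proof -
  have "\<exists>!X. X \<in> bounded_ops \<and> A \<circ> X = cadjoint T \<circ> A \<and> range X \<subseteq> closure (range A)"
  proof (rule ex_ex1I)
    fix X Y assume "X \<in> bounded_ops \<and> A \<circ> X = cadjoint T \<circ> A \<and> range X \<subseteq> closure (range A)"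
      and "Y \<in> bounded_ops \<and> A \<circ> Y = cadjoint T \<circ> A \<and> range Y \<subseteq> closure (range A)"
    then have "X x \<in> closure (range A)" "Y x \<in> closure (range A)" "A (X x) = A (Y x)" for x
      by (auto simp: o_def fun_eq_iff)
    then have "X x = Y x" for x by (rule closure_range_A_eqI)
    then show "X = Y" by blast
  qed (rule A_sharp_exists[OF T])
  from theI'[OF this] have *: "A_sharp A T \<in> bounded_ops" "A \<circ> A_sharp A T = cadjoint T \<circ> A"
    unfolding A_sharp_def by blast+
  show "A_sharp A T \<in> bounded_ops" by fact
  have "T \<in> bounded_ops" using T by (simp add: A_adjointable_ops_def)
  then show "ip (A_sharp A T x) y = ip x (T y)"
    using *(2) cinner_cadjoint[of T y "A x"] unfolding A_cinner_def
    by (metis cinner_commute comp_apply)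
qed

lemma ip_A_sharp_right:
  assumes T: "T \<in> A_adjointable_ops A"
  shows "ip y (A_sharp A T x) = ip (T y) x"
  using ip_A_sharp[OF T, of x y] ip_commute by metis

text \<open>Krein's argument: \<open>B = T\<^sup>\<sharp> T\<close> is symmetric for \<open>ip\<close>, so iterating Cauchy-Schwarz bounds
  \<open>N (B x)\<close> for unit \<open>x\<close> by \<open>2\<^sup>k\<close>-th roots of \<open>N (B\<^bsup>2^k\<^esup> x)\<close>, which grow no faster than
  the norm of \<open>B\<close>.\<close>

lemma A_adjointable_imp_A_bounded:
  assumes T: "T \<in> A_adjointable_ops A"
  shows "T \<in> A_bounded_ops A"
proof -
  define B where "B = A_sharp A T \<circ> T"
  have Tb: "T \<in> bounded_ops" using T by (simp add: A_adjointable_ops_def)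
  have B: "B \<in> bounded_ops"
    unfolding B_def by (intro bounded_ops_comp A_sharp_bounded T Tb)
  have ipB: "ip (B x) y = ip x (B y)" for x y
    unfolding B_def by (simp add: ip_A_sharp[OF T] ip_A_sharp_right[OF T])
  have ipBn: "ip ((B ^^ n) x) y = ip x ((B ^^ n) y)" for n x y
    by (induction n arbitrary: x y) (simp_all add: ipB funpow_swap1)
  obtain K where K: "K > 0" "\<And>x. N x \<le> K * norm x" using N_le_norm by blast
  obtain b where b: "b > 0" "\<And>x. norm (B x) \<le> norm x * b"
    using bounded_linear.pos_bounded[OF bounded_opsD(1)[OF B]] by blast
  have pow_norm: "norm ((B ^^ n) x) \<le> b ^ n * norm x" for n x
  proof (induction n)
    case (Suc n)
    have "norm ((B ^^ Suc n) x) \<le> norm ((B ^^ n) x) * b" using b(2) by simp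
    also have "\<dots> \<le> (b ^ n * norm x) * b" using Suc b(1) by (intro mult_right_mono) auto
    finally show ?case by (simp add: algebra_simps)
  qed simp
  have doubling: "N (B x) ^ (2 ^ k) \<le> N ((B ^^ (2 ^ k)) x)" if "N x = 1" for k x
  proof (induction k)
    case (Suc k)
    define n :: nat where "n = 2 ^ k"
    have "N (B x) ^ (2 ^ Suc k) = (N (B x) ^ n)\<^sup>2"
      by (simp add: n_def power_mult[symmetric] mult.commute)
    also have "\<dots> \<le> (N ((B ^^ n) x))\<^sup>2"
      using Suc.IH by (intro power_mono) (simp_all add: n_def N_nonneg)
    also have "\<dots> = Re (ip ((B ^^ (n + n)) x) x)"
      by (simp add: N_square ipBn funpow_add)
    also have "\<dots> \<le> N ((B ^^ (n + n)) x)"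
      using Cauchy_Schwarz_Re[of "(B ^^ (n + n)) x" x] that by simp
    finally show ?case by (simp add: n_def mult_2)
  qed simp
  have Bunit: "N (B x) \<le> b" if "N x = 1" for x
  proof (rule ccontr)
    assume "\<not> N (B x) \<le> b"
    then have q: "1 < N (B x) / b" using b(1) by simp
    \<comment> \<open>The powers of \<open>N (B x) / b\<close> would exceed every bound, whereas
      \<open>doubling\<close> and \<open>pow_norm\<close> keep them below \<open>K * norm x\<close>
      at the exponents \<open>2 ^ k\<close>.\<close>
    obtain k where k: "K * norm x < (N (B x) / b) ^ k" using real_arch_pow[OF q] by blast
    also have "\<dots> \<le> (N (B x) / b) ^ (2 ^ k)"
      using q by (intro power_increasing) (simp_all add: less_imp_le)
    also have "\<dots> \<le> N ((B ^^ (2 ^ k)) x) / b ^ (2 ^ k)"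
      unfolding power_divide using doubling[OF that] b(1) by (intro divide_right_mono) auto
    also have "\<dots> \<le> K * norm x"
    proof -
      have "N ((B ^^ (2 ^ k)) x) \<le> K * norm ((B ^^ (2 ^ k)) x)" by (rule K(2))
      also have "\<dots> \<le> K * (b ^ (2 ^ k) * norm x)"
        using pow_norm K(1) by (intro mult_left_mono) auto
      finally show ?thesis using b(1) by (simp add: field_simps)
    qed
    finally show False by simp
  qed
  have ipT: "(N (T x))\<^sup>2 \<le> N (B x) * N x" for x
    using Cauchy_Schwarz_Re[of "B x" x] by (simp add: N_square B_def ip_A_sharp[OF T])
  have "N (T x) \<le> sqrt b * N x" for x
  proof (cases "N x = 0")
    case True
    then show ?thesis using ipT[of x] by simp
  next
    case False
    then have Nx: "N x > 0" using N_nonneg[of x] by simp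
    define u where "u = (1 / N x) *\<^sub>R x"
    have u: "N u = 1" using Nx by (simp add: u_def N_scaleR)
    have "(N (T u))\<^sup>2 \<le> b" using ipT[of u] Bunit[OF u] u by simp
    then have "N (T u) \<le> sqrt b" by (simp add: real_le_rsqrt)
    moreover have "T u = (1 / N x) *\<^sub>R T x"
      unfolding u_def using bounded_opsD(1)[OF Tb] by (simp add: linear_cmul bounded_linear.linear)
    ultimately show ?thesis using Nx by (simp add: N_scaleR field_simps)
  qed
  moreover have "0 < sqrt b" using b(1) by simp
  ultimately show ?thesis using Tb unfolding A_bounded_ops_def by blast
qed

lemma Cauchy_Schwarz: "cmod (ip x y) \<le> N x * N y"
proof (cases "ip x y = 0")
  case False
  define a where "a = cnj (sgn (ip x y))"
  have a: "cmod a = 1" using False by (simp add: a_def norm_sgn)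
  have "a * ip x y = of_real (cmod (ip x y))"
    using False by (simp add: a_def sgn_eq field_simps complex_norm_square[symmetric])
       (simp add: power2_eq_square)
  then have "cmod (ip x y) = Re (ip (a *\<^sub>C x) y)" by (simp add: ip_simps)
  also have "\<dots> \<le> N (a *\<^sub>C x) * N y" by (rule Cauchy_Schwarz_Re)
  finally show ?thesis using a by (simp add: N_scaleC)
qed (simp add: N_nonneg)

lemma N_triangle_diff: "N (x - y) \<le> N x + N y"
  using N_triangle[of x "- y"] N_scaleR[of "-1" y] by simp

lemma A_bounded_opsI:
  assumes "T \<in> bounded_ops" "\<And>x. N (T x) \<le> c * N x"
  shows "T \<in> A_bounded_ops A"
proof -
  have "c * N x \<le> (\<bar>c\<bar> + 1) * N x" for x using N_nonneg[of x] by (intro mult_right_mono) auto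
  then have "\<forall>x. N (T x) \<le> (\<bar>c\<bar> + 1) * N x" using assms(2) order_trans by blast
  then show ?thesis using assms(1) unfolding A_bounded_ops_def
    by (auto intro!: exI[of _ "\<bar>c\<bar> + 1"])
qed

end

text \<open>For \<open>u > d\<close> the hypothesis is squared and the term \<open>d\<^sup>2\<close>
  dropped; for \<open>u \<le> d\<close> the left side is not positive.\<close>

lemma power2_diff_le:
  fixes u v d :: real
  assumes "u - d \<le> v" "0 \<le> v" "0 \<le> u" "0 < d"
  shows "u\<^sup>2 - 2 * u * d \<le> v\<^sup>2"
proof (cases "u \<le> d")
  case True
  then have "u * u \<le> u * (2 * d)" using assms by (intro mult_left_mono) auto
  moreover have "0 \<le> v * v" by simp
  ultimately show ?thesis unfolding power2_eq_square by argo
next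
  case False
  then have "(u - d)\<^sup>2 \<le> v\<^sup>2" using assms by (intro power_mono) auto
  then show ?thesis using zero_le_power2[of d] unfolding power2_diff by linarith
qed

subsection \<open>Operator seminorm, parallelism and spectral radius\<close>

locale nonzero_positive_operator = positive_operator +
  assumes nonzero: "A \<noteq> (\<lambda>x. 0)"
begin

abbreviation op_norm :: "('a \<Rightarrow> 'a) \<Rightarrow> real" where "op_norm \<equiv> A_opnorm A"

lemma unit_vector_exists: "\<exists>x. N x = 1"
proof -
  obtain x where "A x \<noteq> 0" using nonzero by auto
  then have "N x > 0" using A_eq_0_of_N[of x] N_nonneg[of x] by (cases "N x = 0") auto
  then have "N ((1 / N x) *\<^sub>R x) = 1" by (simp add: N_scaleR)
  then show ?thesis by blast
qed

lemma op_norm_le: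
  assumes "\<And>x. N x = 1 \<Longrightarrow> N (T x) \<le> c"
  shows "op_norm T \<le> c"
  unfolding A_opnorm_def using unit_vector_exists assms by (intro cSup_least) auto

lemma bdd_above_op_norm:
  assumes "T \<in> A_bounded_ops A"
  shows "bdd_above {N (T x) | x. N x = 1}"
proof -
  obtain c where "\<And>x. N (T x) \<le> c * N x" using assms by (auto simp: A_bounded_ops_def)
  then have "N (T x) \<le> c" if "N x = 1" for x using that by (metis mult.right_neutral)
  then show ?thesis by (intro bdd_aboveI[of _ c]) auto
qed

lemma A_bounded_opsD:
  assumes "T \<in> A_bounded_ops A"
  shows "T \<in> bounded_ops" "T (a *\<^sub>C x) = a *\<^sub>C T x" "T (x + y) = T x + T y" "T (x - y) = T x - T y"
    and A_bounded_scaleR: "T (r *\<^sub>R x) = r *\<^sub>R T x"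
  using assms bounded_opsD[of T] by (auto simp: A_bounded_ops_def linear_cmul bounded_linear.linear)

lemma N_le_op_norm_unit: "T \<in> A_bounded_ops A \<Longrightarrow> N x = 1 \<Longrightarrow> N (T x) \<le> op_norm T"
  unfolding A_opnorm_def by (rule cSup_upper[OF _ bdd_above_op_norm]) auto

lemma op_norm_nonneg: "T \<in> A_bounded_ops A \<Longrightarrow> 0 \<le> op_norm T"
  using unit_vector_exists N_le_op_norm_unit N_nonneg order_trans by blast

lemma N_le_op_norm:
  assumes T: "T \<in> A_bounded_ops A"
  shows "N (T x) \<le> op_norm T * N x"
proof (cases "N x = 0")
  case True
  \<comment> \<open>The supremum over unit vectors does not see vectors of seminorm 0;
    \<open>A\<close>-boundedness itself forces their images to have seminorm 0.\<close>
  obtain c where "N (T x) \<le> c * N x" using T by (auto simp: A_bounded_ops_def)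
  then show ?thesis using True by simp
next
  case False
  then have Nx: "N x > 0" using N_nonneg[of x] by simp
  then have "N (T ((1 / N x) *\<^sub>R x)) \<le> op_norm T"
    by (intro N_le_op_norm_unit T) (simp add: N_scaleR)
  then show ?thesis using Nx by (simp add: A_bounded_scaleR[OF T] N_scaleR field_simps)
qed

lemma op_norm_approx:
  assumes "T \<in> A_bounded_ops A" "e > 0"
  shows "\<exists>x. N x = 1 \<and> op_norm T - e < N (T x)"
proof -
  have "op_norm T - e < Sup {N (T x) | x. N x = 1}" using assms(2) by (simp add: A_opnorm_def)
  moreover have "{N (T x) | x. N x = 1} \<noteq> {}" using unit_vector_exists by auto
  ultimately show ?thesis
    using less_cSup_iff[OF _ bdd_above_op_norm[OF assms(1)]] by auto
qed

lemma A_bounded_comp: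
  assumes T: "T \<in> A_bounded_ops A" and S: "S \<in> A_bounded_ops A"
  shows "T \<circ> S \<in> A_bounded_ops A" and op_norm_comp: "op_norm (T \<circ> S) \<le> op_norm T * op_norm S"
proof -
  have bd: "N ((T \<circ> S) x) \<le> (op_norm T * op_norm S) * N x" for x
  proof -
    have "N ((T \<circ> S) x) \<le> op_norm T * N (S x)" using N_le_op_norm[OF T] by simp
    also have "\<dots> \<le> op_norm T * (op_norm S * N x)"
      by (intro mult_left_mono N_le_op_norm S op_norm_nonneg T)
    finally show ?thesis by (simp add: mult.assoc)
  qed
  show "T \<circ> S \<in> A_bounded_ops A"
    by (rule A_bounded_opsI[OF bounded_ops_comp bd]) (use T S A_bounded_opsD in auto)
  show "op_norm (T \<circ> S) \<le> op_norm T * op_norm S"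
    by (rule op_norm_le) (metis bd mult.right_neutral)
qed

lemma A_bounded_add_scaleC:
  assumes T: "T \<in> A_bounded_ops A" and S: "S \<in> A_bounded_ops A"
  shows "(\<lambda>x. T x + c *\<^sub>C S x) \<in> A_bounded_ops A"
    and op_norm_add_scaleC: "op_norm (\<lambda>x. T x + c *\<^sub>C S x) \<le> op_norm T + cmod c * op_norm S"
proof -
  have bd: "N (T x + c *\<^sub>C S x) \<le> (op_norm T + cmod c * op_norm S) * N x" for x
  proof -
    have "N (T x + c *\<^sub>C S x) \<le> N (T x) + cmod c * N (S x)"
      using N_triangle[of "T x" "c *\<^sub>C S x"] by (simp add: N_scaleC)
    also have "\<dots> \<le> op_norm T * N x + cmod c * (op_norm S * N x)"
      by (intro add_mono mult_left_mono N_le_op_norm S T) simp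
    finally show ?thesis by (simp add: algebra_simps)
  qed
  show "(\<lambda>x. T x + c *\<^sub>C S x) \<in> A_bounded_ops A"
    by (rule A_bounded_opsI[OF bounded_ops_add_scaleC bd]) (use T S A_bounded_opsD in auto)
  show "op_norm (\<lambda>x. T x + c *\<^sub>C S x) \<le> op_norm T + cmod c * op_norm S"
    by (rule op_norm_le) (metis bd mult.right_neutral)
qed

lemma A_bounded_funpow:
  assumes T: "T \<in> A_bounded_ops A"
  shows "T ^^ n \<in> A_bounded_ops A" and op_norm_funpow: "op_norm (T ^^ n) \<le> op_norm T ^ n"
proof -
  have "T ^^ n \<in> A_bounded_ops A \<and> op_norm (T ^^ n) \<le> op_norm T ^ n"
  proof (induction n)
    case 0
    have "bounded_linear (\<lambda>x::'a. x)" by (rule bounded_linear_ident)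
    then have "id \<in> A_bounded_ops A"
      by (intro A_bounded_opsI[where c = 1]) (auto simp: bounded_ops_def id_def)
    moreover have "op_norm id \<le> 1" by (rule op_norm_le) simp
    ultimately show ?case by (simp add: id_def)
  next
    case (Suc n)
    then have "op_norm (T \<circ> T ^^ n) \<le> op_norm T * op_norm T ^ n"
      using op_norm_comp[OF T, of "T ^^ n"] mult_left_mono[OF _ op_norm_nonneg[OF T]] order_trans
      by blast
    with Suc show ?case using A_bounded_comp(1)[OF T, of "T ^^ n"]
      by (simp only: funpow.simps power_Suc simp_thms)
  qed
  then show "T ^^ n \<in> A_bounded_ops A" "op_norm (T ^^ n) \<le> op_norm T ^ n" by auto
qed

text \<open>With \<open>z = A_sharp A T x\<close>, moving \<open>T\<close> across \<open>ip\<close>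
  gives \<open>(N z)\<^sup>2 \<le> N x * (op_norm T * N z)\<close>, and \<open>N z\<close>
  cancels.\<close>

lemma A_sharp_A_bounded:
  assumes T: "T \<in> A_adjointable_ops A"
  shows "A_sharp A T \<in> A_bounded_ops A" and op_norm_A_sharp: "op_norm (A_sharp A T) \<le> op_norm T"
proof -
  note Tb = A_adjointable_imp_A_bounded[OF T]
  have bd: "N (A_sharp A T x) \<le> op_norm T * N x" for x
  proof -
    let ?z = "A_sharp A T x"
    have "(N ?z)\<^sup>2 = Re (ip x (T ?z))" by (simp add: N_square ip_A_sharp[OF T])
    also have "\<dots> \<le> N x * N (T ?z)" by (rule Cauchy_Schwarz_Re)
    also have "\<dots> \<le> N x * (op_norm T * N ?z)"
      by (intro mult_left_mono N_le_op_norm Tb N_nonneg)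
    finally have "N ?z * N ?z \<le> (op_norm T * N x) * N ?z" by (simp add: power2_eq_square algebra_simps)
    then show ?thesis
      using N_nonneg[of ?z] N_nonneg[of x] op_norm_nonneg[OF Tb] by (cases "N ?z = 0") auto
  qed
  show "A_sharp A T \<in> A_bounded_ops A"
    by (rule A_bounded_opsI[OF A_sharp_bounded[OF T] bd])
  show "op_norm (A_sharp A T) \<le> op_norm T"
    by (rule op_norm_le) (metis bd mult.right_neutral)
qed

section \<open>Norm-parallelism and norming vectors\<close>

lemma N_add_scaleC_square:
  assumes "cmod c = 1"
  shows "(N (x + c *\<^sub>C y))\<^sup>2 = (N x)\<^sup>2 + (N y)\<^sup>2 + 2 * Re (cnj c * ip x y)"
  using assms by (simp add: N_add_square N_scaleC ip_simps)

text \<open>At a unit vector nearly attaining \<open>t + s\<close>, the square terms in the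
  expansion of \<open>(N (T x + c *\<^sub>C S x))\<^sup>2\<close> are at most
  \<open>t\<^sup>2\<close> and \<open>s\<^sup>2\<close>, so the cross term must be close to its
  maximum.\<close>

lemma norming_vector_of_parallel:
  assumes T: "T \<in> A_bounded_ops A" and S: "S \<in> A_bounded_ops A" and c: "cmod c = 1"
    and eq: "op_norm (\<lambda>x. T x + c *\<^sub>C S x) = op_norm T + op_norm S" and e: "e > 0"
  shows "\<exists>x. N x = 1 \<and> (op_norm T)\<^sup>2 - e \<le> (N (T x))\<^sup>2 \<and>
    op_norm T * op_norm S - e \<le> Re (cnj c * ip (T x) (S x))"
proof -
  define t s where "t = op_norm T" and "s = op_norm S"
  have ts: "0 \<le> t" "0 \<le> s" using op_norm_nonneg T S by (auto simp: t_def s_def)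
  \<comment> \<open>Makes both losses below, \<open>2 * t * d\<close> and
    \<open>(t + s) * d\<close>, at most \<open>e\<close>; the summand 1 covers
    \<open>t = s = 0\<close>.\<close>
  define d where "d = e / (2 * t + s + 1)"
  have d: "d > 0" using e ts by (simp add: d_def)
  have nn: "0 \<le> d * t" "0 \<le> d * s" using d ts by simp_all
  have de: "d * (2 * t + s) \<le> e"
  proof -
    have "d * (2 * t + s) \<le> d * (2 * t + s + 1)" using d by (simp add: algebra_simps)
    also have "\<dots> = e" using ts by (simp add: d_def)
    finally show ?thesis .
  qed
  obtain x where x: "N x = 1" "t + s - d < N (T x + c *\<^sub>C S x)"
    using op_norm_approx[OF A_bounded_add_scaleC(1)[OF T S] d, of c] eq by (auto simp: t_def s_def)
  have le: "N (T x) \<le> t" "N (S x) \<le> s"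
    using N_le_op_norm_unit T S x(1) by (auto simp: t_def s_def)
  have "N (T x + c *\<^sub>C S x) \<le> N (T x) + N (S x)"
    using N_triangle[of "T x" "c *\<^sub>C S x"] c by (simp add: N_scaleC)
  then have Tx: "t - d \<le> N (T x)" using x(2) le by linarith
  have "t\<^sup>2 - 2 * t * d \<le> (N (T x))\<^sup>2" using power2_diff_le[OF Tx] ts d N_nonneg by auto
  moreover have "2 * t * d \<le> e"
    using de nn by (simp add: algebra_simps)
  ultimately have 1: "t\<^sup>2 - e \<le> (N (T x))\<^sup>2" by linarith
  have "(t + s)\<^sup>2 - 2 * (t + s) * d \<le> (N (T x + c *\<^sub>C S x))\<^sup>2"
    using power2_diff_le[of "t + s" d "N (T x + c *\<^sub>C S x)"] x(2) ts d N_nonneg by auto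
  also have "\<dots> \<le> t\<^sup>2 + s\<^sup>2 + 2 * Re (cnj c * ip (T x) (S x))"
    unfolding N_add_scaleC_square[OF c]
    using power_mono[OF le(1) N_nonneg, of 2] power_mono[OF le(2) N_nonneg, of 2] by linarith
  finally have "t * s - (t + s) * d \<le> Re (cnj c * ip (T x) (S x))"
    by (simp add: power2_sum algebra_simps)
  moreover have "(t + s) * d \<le> e"
    using de nn by (simp add: algebra_simps)
  ultimately have "t * s - e \<le> Re (cnj c * ip (T x) (S x))" by linarith
  with 1 x(1) show ?thesis unfolding t_def s_def by blast
qed

text \<open>A cross term close to \<open>t * s\<close> forces \<open>N (T x) * N (S x)\<close> close
  to \<open>t * s\<close>; dividing by \<open>s\<close> and by \<open>t\<close> shows that each
  factor is nearly maximal, and with them the whole expanded square.\<close>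

lemma parallel_of_norming_vectors:
  assumes T: "T \<in> A_bounded_ops A" and S: "S \<in> A_bounded_ops A" and c: "cmod c = 1"
    and pos: "0 < op_norm T" "0 < op_norm S"
    and ex: "\<And>e. e > 0 \<Longrightarrow> \<exists>x. N x = 1 \<and> op_norm T * op_norm S - e \<le> Re (cnj c * ip (T x) (S x))"
  shows "op_norm (\<lambda>x. T x + c *\<^sub>C S x) = op_norm T + op_norm S"
proof (rule antisym)
  show "op_norm (\<lambda>x. T x + c *\<^sub>C S x) \<le> op_norm T + op_norm S"
    using op_norm_add_scaleC[OF T S, of c] c by simp
  define t s where "t = op_norm T" and "s = op_norm S"
  have ts: "0 < t" "0 < s" using pos by (auto simp: t_def s_def)
  let ?R = "\<lambda>x. T x + c *\<^sub>C S x"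
  have R: "?R \<in> A_bounded_ops A" by (rule A_bounded_add_scaleC[OF T S])
  have "(t + s)\<^sup>2 \<le> (op_norm ?R)\<^sup>2 + h" if "h > 0" for h
  proof -
    \<comment> \<open>\<open>k * e\<close> is the total loss in the three terms of the expanded
      square.\<close>
    define k where "k = 2 * t / s + 2 * s / t + 2"
    have k: "k > 0" using ts by (simp add: k_def add_pos_pos)
    define e where "e = h / k"
    have e: "e > 0" using that k by (simp add: e_def)
    obtain x where x: "N x = 1" "t * s - e \<le> Re (cnj c * ip (T x) (S x))"
      using ex[OF e] by (auto simp: t_def s_def)
    have le: "N (T x) \<le> t" "N (S x) \<le> s"
      using N_le_op_norm_unit T S x(1) by (auto simp: t_def s_def)
    have "Re (cnj c * ip (T x) (S x)) \<le> N (T x) * N (S x)"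
      using complex_Re_le_cmod[of "cnj c * ip (T x) (S x)"] Cauchy_Schwarz[of "T x" "S x"] c
      by (simp add: norm_mult)
    then have prod: "t * s - e \<le> N (T x) * N (S x)" using x(2) by linarith
    have "N (T x) * N (S x) \<le> N (T x) * s" "N (T x) * N (S x) \<le> t * N (S x)"
      using le N_nonneg by (auto intro: mult_left_mono mult_right_mono)
    then have "t * s - e \<le> N (T x) * s" "t * s - e \<le> t * N (S x)" using prod by auto
    then have ge: "t - e / s \<le> N (T x)" "s - e / t \<le> N (S x)"
      using ts by (simp_all add: field_simps)
    have "t\<^sup>2 - 2 * t * (e / s) \<le> (N (T x))\<^sup>2" "s\<^sup>2 - 2 * s * (e / t) \<le> (N (S x))\<^sup>2"
      using power2_diff_le[OF ge(1)] power2_diff_le[OF ge(2)] ts e N_nonneg by auto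
    moreover have "2 * t * (e / s) + 2 * s * (e / t) + 2 * e = h"
    proof -
      have "2 * t * (e / s) + 2 * s * (e / t) + 2 * e = k * e" by (simp add: k_def algebra_simps)
      then show ?thesis using k by (simp add: e_def)
    qed
    ultimately have "(t + s)\<^sup>2 - h \<le> (N (?R x))\<^sup>2"
      unfolding N_add_scaleC_square[OF c] using x(2) by (simp add: power2_sum)
    also have "\<dots> \<le> (op_norm ?R)\<^sup>2"
      by (intro power_mono N_le_op_norm_unit[OF R] x(1) N_nonneg)
    finally show ?thesis by simp
  qed
  then have "(t + s)\<^sup>2 \<le> (op_norm ?R)\<^sup>2" by (rule field_le_epsilon)
  then show "op_norm T + op_norm S \<le> op_norm ?R"
    unfolding t_def s_def by (rule power2_le_imp_le) (rule op_norm_nonneg[OF R])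
qed

text \<open>By the reverse triangle inequality, adding an operator of seminorm 0 does not change the
  seminorm, so \<open>c = 1\<close> works.\<close>

lemma parallel_of_zero:
  assumes T: "T \<in> A_bounded_ops A" and S: "S \<in> A_bounded_ops A"
    and "op_norm T = 0 \<or> op_norm S = 0"
  shows "op_norm (\<lambda>x. T x + 1 *\<^sub>C S x) = op_norm T + op_norm S"
proof (rule antisym)
  let ?R = "\<lambda>x. T x + 1 *\<^sub>C S x"
  show "op_norm ?R \<le> op_norm T + op_norm S"
    using op_norm_add_scaleC[OF T S, of 1] by simp
  note R = A_bounded_add_scaleC(1)[OF T S, of 1]
  have one: "1 *\<^sub>C y = y" for y :: 'a using scaleC_of_real[of 1 y] by simp
  have "op_norm S \<le> op_norm ?R + op_norm T"
  proof (rule op_norm_le)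
    fix x assume x: "N x = 1"
    have "N (S x) \<le> N (?R x) + N (T x)"
      using N_triangle_diff[of "T x + S x" "T x"] by (simp add: one)
    then show "N (S x) \<le> op_norm ?R + op_norm T"
      using N_le_op_norm_unit[OF R x] N_le_op_norm_unit[OF T x] by linarith
  qed
  moreover have "op_norm T \<le> op_norm ?R + op_norm S"
  proof (rule op_norm_le)
    fix x assume x: "N x = 1"
    have "N (T x) \<le> N (?R x) + N (S x)"
      using N_triangle_diff[of "T x + S x" "S x"] by (simp add: one)
    then show "N (T x) \<le> op_norm ?R + op_norm S"
      using N_le_op_norm_unit[OF R x] N_le_op_norm_unit[OF S x] by linarith
  qed
  ultimately show "op_norm T + op_norm S \<le> op_norm ?R" using assms(3) by auto
qed

section \<open>Approximate eigenvectors and the spectral radius\<close>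

lemma op_norm_ge_of_norming_vectors:
  assumes U: "U \<in> A_bounded_ops A" and c: "cmod c = 1"
    and ex: "\<And>e. e > 0 \<Longrightarrow> \<exists>x. N x = 1 \<and> M - e \<le> Re (c * ip (U x) x)"
  shows "M \<le> op_norm U"
proof (rule field_le_epsilon)
  fix e :: real assume "e > 0"
  then obtain x where x: "N x = 1" "M - e \<le> Re (c * ip (U x) x)" using ex by blast
  have "Re (c * ip (U x) x) \<le> N (U x)"
    using complex_Re_le_cmod[of "c * ip (U x) x"] Cauchy_Schwarz[of "U x" x] c x(1)
    by (simp add: norm_mult)
  then show "M \<le> op_norm U + e" using N_le_op_norm_unit[OF U x(1)] x(2) by linarith
qed

text \<open>Such vectors are approximate eigenvectors for \<open>d = M * c\<close>, so
  \<open>U ^^ n\<close> acts on them nearly as \<open>d ^ n\<close>. Hence all roots in the infimum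
  equal \<open>M\<close>.\<close>

lemma spectral_radius_of_norming_vectors:
  assumes U: "U \<in> A_bounded_ops A" and c: "cmod c = 1"
    and ex: "\<And>e. e > 0 \<Longrightarrow> \<exists>x. N x = 1 \<and> op_norm U - e \<le> Re (cnj c * ip (U x) x)"
  shows "A_spectral_radius A U = op_norm U"
proof -
  define M where "M = op_norm U"
  have M: "0 \<le> M" using op_norm_nonneg[OF U] by (simp add: M_def)
  define d where "d = of_real M * c"
  have cd: "cmod d = M" using M c by (simp add: d_def norm_mult)
  \<comment> \<open>Each application of \<open>U\<close> multiplies the old error by at most
    \<open>M\<close> and adds one further error of the same size.\<close>
  have pow: "N ((U ^^ Suc n) x - d ^ Suc n *\<^sub>C x) \<le> real (Suc n) * M ^ n * N (U x - d *\<^sub>C x)" for n x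
  proof (induction n)
    case 0
    then show ?case by simp
  next
    case (Suc n)
    let ?y = "(U ^^ Suc n) x - d ^ Suc n *\<^sub>C x"
    have "(U ^^ Suc (Suc n)) x - d ^ Suc (Suc n) *\<^sub>C x = U ?y + d ^ Suc n *\<^sub>C (U x - d *\<^sub>C x)"
      using scaleC_add_right[of "d ^ Suc n" "U x - d *\<^sub>C x" "d *\<^sub>C x"]
      by (simp add: A_bounded_opsD[OF U] scaleC_scaleC mult_ac)
    then have "N ((U ^^ Suc (Suc n)) x - d ^ Suc (Suc n) *\<^sub>C x)
        \<le> N (U ?y) + M ^ Suc n * N (U x - d *\<^sub>C x)"
      using N_triangle[of "U ?y" "d ^ Suc n *\<^sub>C (U x - d *\<^sub>C x)"]
      by (simp only: N_scaleC norm_power cd)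
    moreover have "N (U ?y) \<le> M * (real (Suc n) * M ^ n * N (U x - d *\<^sub>C x))"
      using N_le_op_norm[OF U, of ?y] mult_left_mono[OF Suc.IH M] unfolding M_def by linarith
    ultimately show ?case by (simp add: algebra_simps)
  qed
  have norm_pow: "op_norm (U ^^ Suc n) = M ^ Suc n" for n
  proof (rule antisym)
    show "op_norm (U ^^ Suc n) \<le> M ^ Suc n" using op_norm_funpow[OF U] by (simp only: M_def)
    show "M ^ Suc n \<le> op_norm (U ^^ Suc n)"
    proof (rule field_le_epsilon)
      fix h :: real assume h: "h > 0"
      define k where "k = real (Suc n) * M ^ n"
      have k: "0 \<le> k" using M by (simp add: k_def)
      \<comment> \<open>The squared defect will be at most \<open>2 * M * e\<close>, hence at most
        \<open>(h / (k + 1))\<^sup>2\<close>; the summands 1 cover \<open>M = 0\<close> and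
        \<open>k = 0\<close>.\<close>
      define e where "e = (h / (k + 1))\<^sup>2 / (2 * M + 1)"
      have e: "e > 0" using h k M by (simp add: e_def add_nonneg_pos)
      obtain x where x: "N x = 1" "M - e \<le> Re (cnj c * ip (U x) x)"
        using ex[OF e] by (auto simp: M_def)
      have "(N (U x - d *\<^sub>C x))\<^sup>2 = (N (U x))\<^sup>2 + M\<^sup>2 - 2 * (M * Re (cnj c * ip (U x) x))"
        by (simp add: N_diff_square N_scaleC cd x(1) ip_simps) (simp add: d_def algebra_simps)
      also have "\<dots> \<le> M\<^sup>2 + M\<^sup>2 - 2 * (M * (M - e))"
        using power_mono[OF N_le_op_norm_unit[OF U x(1)] N_nonneg, of 2] mult_left_mono[OF x(2) M]
        unfolding M_def by linarith
      also have "\<dots> = 2 * M * e" by (simp add: power2_eq_square algebra_simps)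
      also have "\<dots> \<le> (2 * M + 1) * e" using e by (simp add: algebra_simps)
      also have "\<dots> = (h / (k + 1))\<^sup>2" using M by (simp add: e_def)
      finally have "N (U x - d *\<^sub>C x) \<le> h / (k + 1)"
        by (rule power2_le_imp_le) (use h k in auto)
      then have "k * N (U x - d *\<^sub>C x) \<le> k * (h / (k + 1))" using k by (rule mult_left_mono)
      also have "\<dots> \<le> h" using h k by (simp add: field_simps)
      finally have "N ((U ^^ Suc n) x - d ^ Suc n *\<^sub>C x) \<le> h"
        using pow[of n x] unfolding k_def by linarith
      moreover have "N (d ^ Suc n *\<^sub>C x) = M ^ Suc n" by (simp only: N_scaleC norm_power cd x(1))
      moreover have "N (d ^ Suc n *\<^sub>C x) \<le> N ((U ^^ Suc n) x) + N ((U ^^ Suc n) x - d ^ Suc n *\<^sub>C x)"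
        using N_triangle_diff[of "(U ^^ Suc n) x" "(U ^^ Suc n) x - d ^ Suc n *\<^sub>C x"] by simp
      ultimately show "M ^ Suc n \<le> op_norm (U ^^ Suc n) + h"
        using N_le_op_norm_unit[OF A_bounded_funpow(1)[OF U] x(1), of "Suc n"] by linarith
    qed
  qed
  have "root n (op_norm (U ^^ n)) = M" if "n \<in> {1..}" for n
  proof -
    obtain m where n: "n = Suc m" using \<open>n \<in> {1..}\<close> by (cases n) auto
    show ?thesis unfolding n norm_pow using M by (intro real_root_power_cancel) simp_all
  qed
  then have "A_spectral_radius A U = (INF n\<in>{1::nat..}. M)"
    unfolding A_spectral_radius_def by (intro INF_cong) auto
  also have "\<dots> = M" by (rule cINF_const) auto
  finally show ?thesis by (simp add: M_def)
qed

text \<open>The infimum is a lower bound for every root; \<open>Suc n\<close> keeps the exponent in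
  the index set \<open>{1..}\<close>.\<close>

lemma op_norm_funpow_of_spectral_radius:
  assumes U: "U \<in> A_bounded_ops A" and r: "A_spectral_radius A U = op_norm U"
  shows "op_norm U ^ Suc n \<le> op_norm (U ^^ Suc n)"
proof -
  have nn: "0 \<le> op_norm (U ^^ k)" for k by (intro op_norm_nonneg A_bounded_funpow U)
  have "bdd_below ((\<lambda>n. root n (op_norm (U ^^ n))) ` {1..})"
    using nn by (intro bdd_belowI[of _ 0]) (auto intro: real_root_ge_zero)
  then have "op_norm U \<le> root (Suc n) (op_norm (U ^^ Suc n))"
    unfolding r[symmetric] A_spectral_radius_def by (rule cINF_lower) simp
  then have "op_norm U ^ Suc n \<le> root (Suc n) (op_norm (U ^^ Suc n)) ^ Suc n"
    by (rule power_mono) (rule op_norm_nonneg[OF U])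
  also have "\<dots> = op_norm (U ^^ Suc n)" by (rule real_root_pow_pos2[OF _ nn]) simp
  finally show ?thesis .
qed

text \<open>Factor \<open>U\<^bsup>2p\<^esup> - c = (U\<^sup>p - d) (U\<^sup>p + d)\<close> with \<open>d\<^sup>2 = c\<close>. By the parallelogram law one of
  \<open>U\<^sup>p x \<plusminus> d x\<close> gains a factor 2, so that after \<open>m\<close> steps the defect \<open>U y - d y\<close> is small
  compared with \<open>U y\<close>.\<close>

lemma approx_eigenvector_doubling:
  assumes U: "U \<in> A_bounded_ops A" and "cmod c = op_norm U ^ (2 ^ m)"
  shows "\<exists>d y. cmod d = op_norm U \<and> 2 ^ m * (N ((U ^^ (2 ^ m)) x))\<^sup>2 \<le> (N (U y))\<^sup>2 \<and>
    N (U y - d *\<^sub>C y) = N ((U ^^ (2 ^ m)) x - c *\<^sub>C x)"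
  using assms(2)
proof (induction m arbitrary: x c)
  case 0
  then show ?case by (intro exI[of _ c] exI[of _ x]) simp
next
  case (Suc m)
  define M where "M = op_norm U"
  define p :: nat where "p = 2 ^ m"
  define V where "V = U ^^ p"
  have M: "0 \<le> M" unfolding M_def by (rule op_norm_nonneg[OF U])
  have Vb: "V \<in> A_bounded_ops A" unfolding V_def by (rule A_bounded_funpow[OF U])
  note V = A_bounded_opsD[OF Vb]
  have U2p: "U ^^ (2 ^ Suc m) = V \<circ> V" by (simp add: V_def p_def funpow_add[symmetric] mult_2)
  define d where "d = csqrt c"
  have d2: "d * d = c" using power2_csqrt[of c] by (simp add: d_def power2_eq_square)
  have "cmod d ^ 2 = (M ^ p)\<^sup>2"
    using Suc.prems d2 by (simp add: power2_eq_square norm_mult[symmetric] M_def p_def power_add[symmetric] mult_2)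
  then have cd: "cmod d = M ^ p" using M by (simp add: power2_eq_iff_nonneg)
  have VV: "N (V (V x)) \<le> cmod d * N (V x)"
    using order_trans[OF N_le_op_norm[OF Vb, of "V x"] mult_right_mono[OF _ N_nonneg]]
      op_norm_funpow[OF U, of p] unfolding cd by (simp add: V_def M_def)
  define g where "g e = V x + e *\<^sub>C x" for e
  \<comment> \<open>Two of four copies of \<open>(N (V (V x)))\<^sup>2\<close> are traded for
    \<open>(cmod d)\<^sup>2 * (N (V x))\<^sup>2\<close>, as the parallelogram law for
    \<open>V (V x)\<close> and \<open>d *\<^sub>C V x\<close> requires.\<close>
  have "N (V (V x)) * N (V (V x)) \<le> (cmod d * N (V x)) * (cmod d * N (V x))"
    by (intro mult_mono VV) (auto simp: N_nonneg)
  then have "4 * (N (V (V x)))\<^sup>2 \<le> 2 * (N (V (V x)))\<^sup>2 + 2 * (cmod d)\<^sup>2 * (N (V x))\<^sup>2"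
    by (simp add: power2_eq_square algebra_simps)
  also have "\<dots> = (N (V (g d)))\<^sup>2 + (N (V (g (- d))))\<^sup>2"
    unfolding g_def by (simp add: V N_add_square N_scaleC ip_simps power_mult_distrib algebra_simps)
  finally have "2 * (N (V (V x)))\<^sup>2 \<le> (N (V (g d)))\<^sup>2 \<or> 2 * (N (V (V x)))\<^sup>2 \<le> (N (V (g (- d))))\<^sup>2"
    by linarith
  then obtain e where e: "e * e = c" "cmod e = M ^ p" "2 * (N (V (V x)))\<^sup>2 \<le> (N (V (g e)))\<^sup>2"
  proof
    assume "2 * (N (V (V x)))\<^sup>2 \<le> (N (V (g d)))\<^sup>2"
    then show ?thesis using that[of d] d2 cd by simp
  next
    assume "2 * (N (V (V x)))\<^sup>2 \<le> (N (V (g (- d))))\<^sup>2"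
    then show ?thesis using that[of "- d"] d2 cd by simp
  qed
  obtain d' y where d': "cmod d' = M" "2 ^ m * (N (V (g e)))\<^sup>2 \<le> (N (U y))\<^sup>2"
    "N (U y - d' *\<^sub>C y) = N (V (g e) - e *\<^sub>C g e)"
    using Suc.IH[of e "g e"] e(2) unfolding M_def V_def p_def by auto
  have "V (g e) - e *\<^sub>C g e = V (V x) - c *\<^sub>C x"
    by (simp add: g_def V scaleC_add_right scaleC_scaleC e(1))
  then have "N (U y - d' *\<^sub>C y) = N ((V \<circ> V) x - c *\<^sub>C x)" using d'(3) by simp
  moreover have "2 ^ Suc m * (N ((V \<circ> V) x))\<^sup>2 \<le> (N (U y))\<^sup>2"
  proof -
    have "2 ^ m * (2 * (N (V (V x)))\<^sup>2) \<le> 2 ^ m * (N (V (g e)))\<^sup>2"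
      by (rule mult_left_mono[OF e(3)]) simp
    then have "2 ^ m * (2 * (N (V (V x)))\<^sup>2) \<le> (N (U y))\<^sup>2" using d'(2) by (rule order_trans)
    then show ?thesis by (simp add: mult_ac)
  qed
  ultimately show ?case unfolding U2p using d'(1) unfolding M_def by blast
qed

text \<open>\<open>U ^^ (2 ^ m)\<close> has full seminorm, which
  \<open>approx_eigenvector_doubling\<close> converts into a good approximate eigenvector. The phase
  may vary with \<open>e\<close>; \<open>common_phase\<close> removes this dependence.\<close>

lemma norming_vectors_of_spectral_radius:
  assumes U: "U \<in> A_bounded_ops A" and r: "A_spectral_radius A U = op_norm U"
    and M_pos: "0 < op_norm U" and e: "e > 0"
  shows "\<exists>c x. cmod c = 1 \<and> N x = 1 \<and> op_norm U - e \<le> Re (cnj c * ip (U x) x)"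
proof -
  define M where "M = op_norm U"
  have M: "M > 0" using M_pos by (simp add: M_def)
  \<comment> \<open>The gain \<open>2 ^ m\<close> must absorb the crude factor 16 in the defect
    bound and the ratio \<open>M\<^sup>2 / e\<^sup>2\<close>.\<close>
  obtain m where m: "16 * M\<^sup>2 / e\<^sup>2 < 2 ^ m" using real_arch_pow[of 2] by auto
  define n :: nat where "n = 2 ^ m"
  have "M ^ n \<le> op_norm (U ^^ n)"
    using op_norm_funpow_of_spectral_radius[OF U r, of "n - 1"] by (simp add: n_def M_def)
  moreover obtain x where x: "N x = 1" "op_norm (U ^^ n) - M ^ n / 2 < N ((U ^^ n) x)"
    using op_norm_approx[OF A_bounded_funpow(1)[OF U], of "M ^ n / 2" n] M by auto
  ultimately have q: "M ^ n / 2 < N ((U ^^ n) x)" by linarith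
  \<comment> \<open>Any scalar of modulus \<open>M ^ n\<close> would serve, since the defect at
    \<open>x\<close> is estimated by the triangle inequality alone.\<close>
  define c where "c = complex_of_real (M ^ n)"
  have cc: "cmod c = M ^ n" using M by (simp add: c_def norm_power)
  obtain d y where d: "cmod d = M" and y: "2 ^ m * (N ((U ^^ n) x))\<^sup>2 \<le> (N (U y))\<^sup>2"
    "N (U y - d *\<^sub>C y) = N ((U ^^ n) x - c *\<^sub>C x)"
    using approx_eigenvector_doubling[OF U, of c m x] cc unfolding n_def M_def by auto
  have "0 < N ((U ^^ n) x)" using q M zero_less_power[OF M, of n] by linarith
  then have "0 < (N (U y))\<^sup>2" using y(1) by (intro less_le_trans[OF _ y(1)]) simp
  moreover have Uy: "N (U y) \<le> M * N y" unfolding M_def by (rule N_le_op_norm[OF U])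
  ultimately have Ny: "N y > 0"
    using N_nonneg[of y] N_nonneg[of "U y"] by (cases "N y = 0") auto
  have "N (U y - d *\<^sub>C y) \<le> N ((U ^^ n) x) + M ^ n"
    using N_triangle_diff[of "(U ^^ n) x" "c *\<^sub>C x"] by (simp add: y(2) N_scaleC cc x(1))
  then have "N (U y - d *\<^sub>C y) \<le> 4 * N ((U ^^ n) x)" using q N_nonneg[of "(U ^^ n) x"] by linarith
  then have "(N (U y - d *\<^sub>C y))\<^sup>2 \<le> (4 * N ((U ^^ n) x))\<^sup>2" by (intro power_mono N_nonneg)
  also have "\<dots> = 16 * (N ((U ^^ n) x))\<^sup>2" by (simp add: power_mult_distrib)
  also have "\<dots> \<le> 16 * ((M * N y)\<^sup>2 / 2 ^ m)"
    using order_trans[OF y(1) power_mono[OF Uy N_nonneg, of 2]] by (simp add: field_simps)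
  also have "\<dots> = (16 * M\<^sup>2 / 2 ^ m) * (N y)\<^sup>2" by (simp add: power_mult_distrib)
  also have "\<dots> \<le> e\<^sup>2 * (N y)\<^sup>2"
    using m e by (intro mult_right_mono) (simp_all add: field_simps)
  finally have "(N (U y - d *\<^sub>C y))\<^sup>2 \<le> (e * N y)\<^sup>2" by (simp add: power_mult_distrib)
  then have defect: "N (U y - d *\<^sub>C y) \<le> e * N y" 
    by (rule power2_le_imp_le) (use e N_nonneg in auto)
  define v where "v = (1 / N y) *\<^sub>R y"
  have v: "N v = 1" using Ny by (simp add: v_def N_scaleR)
  define w where "w = U v - d *\<^sub>C v"
  have w_eq: "w = (1 / N y) *\<^sub>R (U y - d *\<^sub>C y)"
    by (simp add: w_def v_def A_bounded_opsD(2)[OF U] scaleC_diff_right scaleC_scaleC mult.commute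
        flip: scaleC_of_real)
  have Nw: "N w \<le> e" unfolding w_eq N_scaleR using defect Ny by (simp add: field_simps)
  define k where "k = d / of_real M"
  have k: "cmod k = 1" using d M by (simp add: k_def norm_divide)
  have ipv: "ip v v = 1" using N_square[of v] v ip_self(1)[of v] by (simp add: complex_eq_iff)
  have "cnj k * d = of_real M"
    using d M complex_norm_square[of d]
    by (simp add: k_def field_simps power2_eq_square flip: of_real_mult)
  moreover have "cnj k * ip (U v) v = cnj k * ip w v + (cnj k * d) * ip v v"
    by (simp add: w_def ip_simps algebra_simps)
  ultimately have "Re (cnj k * ip (U v) v) = Re (cnj k * ip w v) + M" by (simp add: ipv)
  moreover have "- e \<le> Re (cnj k * ip w v)"
    using abs_Re_le_cmod[of "cnj k * ip w v"] Cauchy_Schwarz[of w v] k v Nw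
    by (simp add: norm_mult)
  ultimately show ?thesis using k v unfolding M_def by (intro exI[of _ k] exI[of _ v]) auto
qed

text \<open>The unit circle is compact, so some subsequence of phases converges to a limit
  \<open>l\<close>. Replacing a phase by \<open>l\<close> changes the real part by at most their
  distance times \<open>op_norm U\<close>.\<close>

lemma common_phase:
  assumes U: "U \<in> A_bounded_ops A" and M: "0 < op_norm U"
    and ex: "\<And>e. e > 0 \<Longrightarrow> \<exists>c x. cmod c = 1 \<and> N x = 1 \<and> L - e \<le> Re (cnj c * ip (U x) x)"
  shows "\<exists>c. cmod c = 1 \<and> (\<forall>e>0. \<exists>x. N x = 1 \<and> L - e \<le> Re (cnj c * ip (U x) x))"
proof -
  have "\<exists>c x. cmod c = 1 \<and> N x = 1 \<and> L - 1 / real (Suc n) \<le> Re (cnj c * ip (U x) x)" for n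
    by (rule ex) simp
  then obtain c x where c: "\<And>n. cmod (c n) = 1" and x: "\<And>n. N (x n) = 1"
    "\<And>n. L - 1 / real (Suc n) \<le> Re (cnj (c n) * ip (U (x n)) (x n))" by metis
  have "compact (sphere (0::complex) 1)" by simp
  then obtain l r where l: "l \<in> sphere 0 1" "strict_mono r" "(c \<circ> r) \<longlonglongrightarrow> l"
    unfolding compact_def using c by (metis dist_0_norm mem_sphere)
  have "\<exists>x. N x = 1 \<and> L - e \<le> Re (cnj l * ip (U x) x)" if e: "e > 0" for e
  proof -
    \<comment> \<open>Half of \<open>e\<close> pays for the change of phase, the other half for
      \<open>1 / Suc (r n)\<close>, which is at most \<open>1 / Suc n\<close>.\<close>
    have "\<forall>\<^sub>F n in sequentially. dist ((c \<circ> r) n) l < e / (2 * op_norm U)"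
      using e M by (intro tendstoD[OF l(3)]) simp
    moreover have "(\<lambda>n. 1 / real (Suc n)) \<longlonglongrightarrow> 0" by (intro LIMSEQ_Suc lim_1_over_n)
    then have "\<forall>\<^sub>F n in sequentially. 1 / real (Suc n) < e / 2"
      using e by (auto dest!: order_tendstoD(2)[of _ _ _ "e / 2"])
    ultimately have "\<forall>\<^sub>F n in sequentially.
        dist ((c \<circ> r) n) l < e / (2 * op_norm U) \<and> 1 / real (Suc n) < e / 2"
      by (rule eventually_conj)
    then obtain n where n: "dist (c (r n)) l < e / (2 * op_norm U)" "1 / real (Suc n) < e / 2"
      unfolding eventually_sequentially by auto
    let ?w = "ip (U (x (r n))) (x (r n))"
    have "cmod ?w \<le> op_norm U"
      using Cauchy_Schwarz[of "U (x (r n))" "x (r n)"] N_le_op_norm_unit[OF U x(1)[of "r n"]] x(1)[of "r n"]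
      by simp
    then have "cmod (cnj (c (r n) - l) * ?w) \<le> e / (2 * op_norm U) * op_norm U"
      unfolding norm_mult complex_mod_cnj using n(1) M e
      by (intro mult_mono) (auto simp: dist_norm)
    then have "Re (cnj (c (r n) - l) * ?w) \<le> e / 2"
      using M complex_Re_le_cmod[of "cnj (c (r n) - l) * ?w"] by simp
    moreover have "1 / real (Suc (r n)) \<le> 1 / real (Suc n)"
      using seq_suble[OF l(2), of n] by (intro divide_left_mono) auto
    moreover have "Re (cnj (c (r n) - l) * ?w) = Re (cnj (c (r n)) * ?w) - Re (cnj l * ?w)"
      by (simp add: algebra_simps)
    ultimately have "L - e \<le> Re (cnj l * ?w)" using x(2)[of "r n"] n(2) by linarith
    then show ?thesis using x(1) by blast
  qed
  then show ?thesis using l(1) by auto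
qed

end

section \<open>Equivalence of the four conditions\<close>

theorem theorem2p1:
  fixes A T S :: "'a::complex_hilbert_space \<Rightarrow> 'a"
  assumes nontrivial: "(UNIV :: 'a set) \<noteq> {0}"
    and A_pos: "positive_op A"
    and A_nonzero: "A \<noteq> (\<lambda>x. 0)"
    and T: "T \<in> A_adjointable_ops A"
    and S: "S \<in> A_adjointable_ops A"
  shows
    "(A_parallel A T S
       \<longleftrightarrow> A_spectral_radius A (A_sharp A S \<circ> T) = A_opnorm A (A_sharp A S \<circ> T) \<and>
           A_opnorm A (A_sharp A S \<circ> T) = A_opnorm A (A_sharp A T \<circ> S) \<and>
           A_opnorm A (A_sharp A T \<circ> S) = A_opnorm A T * A_opnorm A S) \<and>
     (A_parallel A T S
       \<longleftrightarrow> A_parallel A (A_sharp A T \<circ> T) (A_sharp A T \<circ> S) \<and>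
           A_opnorm A (A_sharp A T \<circ> S) = A_opnorm A T * A_opnorm A S) \<and>
     (A_parallel A T S
       \<longleftrightarrow> (\<exists>c. cmod c = 1 \<and>
             A_opnorm A (A_sharp A T \<circ> (\<lambda>x. T x + c *\<^sub>C S x))
               = A_opnorm A T * (A_opnorm A T + A_opnorm A S)))"
    (is "(?P1 \<longleftrightarrow> ?P2) \<and> (?P1 \<longleftrightarrow> ?P3) \<and> (?P1 \<longleftrightarrow> ?P4)")
proof -
  interpret nonzero_positive_operator A
    by unfold_locales (rule A_pos, rule A_nonzero)
  define t s where "t = op_norm T" and "s = op_norm S"
  let ?T' = "A_sharp A T" and ?S' = "A_sharp A S"
  note Tb = A_adjointable_imp_A_bounded[OF T] and Sb = A_adjointable_imp_A_bounded[OF S]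
  note T'b = A_sharp_A_bounded(1)[OF T] and S'b = A_sharp_A_bounded(1)[OF S]
  have ts: "0 \<le> t" "0 \<le> s" using op_norm_nonneg Tb Sb by (auto simp: t_def s_def)
  let ?R = "\<lambda>c x. T x + c *\<^sub>C S x"
  note Rb = A_bounded_add_scaleC(1)[OF Tb Sb]
  note T'Tb = A_bounded_comp(1)[OF T'b Tb] and T'Sb = A_bounded_comp(1)[OF T'b Sb]
    and S'Tb = A_bounded_comp(1)[OF S'b Tb] and T'Rb = A_bounded_comp(1)[OF T'b Rb]
  have T'_le: "op_norm (?T' \<circ> V) \<le> t * op_norm V" if "V \<in> A_bounded_ops A" for V
    using order_trans[OF op_norm_comp[OF T'b that] mult_right_mono[OF op_norm_A_sharp[OF T] op_norm_nonneg[OF that]]]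
    by (simp add: t_def)
  have S'_le: "op_norm (?S' \<circ> V) \<le> s * op_norm V" if "V \<in> A_bounded_ops A" for V
    using order_trans[OF op_norm_comp[OF S'b that] mult_right_mono[OF op_norm_A_sharp[OF S] op_norm_nonneg[OF that]]]
    by (simp add: s_def)
  have R_le: "op_norm (?R c) \<le> t + s" if "cmod c = 1" for c
    using op_norm_add_scaleC[OF Tb Sb, of c] that by (simp add: t_def s_def)
  have T'R: "?T' \<circ> ?R c = (\<lambda>x. (?T' \<circ> T) x + c *\<^sub>C (?T' \<circ> S) x)" for c
    by (auto simp: A_bounded_opsD[OF T'b])
  \<comment> \<open>The analogue of the C-star identity: \<open>(N (T x))\<^sup>2\<close> is the
    diagonal value of \<open>?T' \<circ> T\<close> at \<open>x\<close>.\<close>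
  have T'T: "op_norm (?T' \<circ> T) = t\<^sup>2"
  proof (rule antisym)
    show "op_norm (?T' \<circ> T) \<le> t\<^sup>2" using T'_le[OF Tb] by (simp add: t_def power2_eq_square)
    have "t \<le> sqrt (op_norm (?T' \<circ> T))"
      unfolding t_def
    proof (rule op_norm_le)
      fix x assume x: "N x = 1"
      have "(N (T x))\<^sup>2 = Re (ip ((?T' \<circ> T) x) x)" by (simp add: N_square ip_A_sharp[OF T])
      also have "\<dots> \<le> op_norm (?T' \<circ> T)"
        using Cauchy_Schwarz_Re[of "(?T' \<circ> T) x" x] N_le_op_norm_unit[OF T'Tb x] x by simp
      finally show "N (T x) \<le> sqrt (op_norm (?T' \<circ> T))" by (rule real_le_rsqrt)
    qed
    then show "t\<^sup>2 \<le> op_norm (?T' \<circ> T)"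
      using ts power_mono[of t "sqrt (op_norm (?T' \<circ> T))" 2] op_norm_nonneg[OF T'Tb] by simp
  qed
  \<comment> \<open>Settles the degenerate cases: cancelling \<open>t\<close> in (4) needs
    \<open>t > 0\<close>, and \<open>parallel_of_norming_vectors\<close>, used from (2), needs
    \<open>t\<close> and \<open>s\<close> positive.\<close>
  have zero: ?P1 if "t = 0 \<or> s = 0"
    using parallel_of_zero[OF Tb Sb] that Tb Sb unfolding A_parallel_def t_def s_def
    by (intro conjI exI[of _ 1]) auto
  have P4_P1: ?P1 if ?P4
  proof (cases "t = 0")
    case False
    then have t: "t > 0" using ts by simp
    obtain c where c: "cmod c = 1" "op_norm (?T' \<circ> ?R c) = t * (t + s)"
      using \<open>?P4\<close> unfolding t_def s_def by blast
    have "t * (t + s) \<le> t * op_norm (?R c)" using T'_le[OF Rb, of c] c(2) by simp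
    then have "t + s \<le> op_norm (?R c)" using t by simp
    then have "op_norm (?R c) = t + s" using R_le[OF c(1)] by simp
    then show ?thesis using Tb Sb c(1) unfolding A_parallel_def t_def s_def by blast
  qed (simp add: zero)
  \<comment> \<open>\<open>?T' \<circ> ?R c\<close> is the combination of the two parallel
    operators, whose seminorms \<open>t\<^sup>2\<close> and \<open>t * s\<close> add up to
    \<open>t * (t + s)\<close>.\<close>
  have P3_P4: ?P4 if ?P3
  proof -
    obtain c where c: "cmod c = 1"
      "op_norm (\<lambda>x. (?T' \<circ> T) x + c *\<^sub>C (?T' \<circ> S) x) = op_norm (?T' \<circ> T) + op_norm (?T' \<circ> S)"
      using \<open>?P3\<close> unfolding A_parallel_def by blast
    have "op_norm (?T' \<circ> S) = t * s" using \<open>?P3\<close> by (simp add: t_def s_def)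
    then have "op_norm (?T' \<circ> ?R c) = t * (t + s)"
      unfolding T'R c(2) T'T by (simp add: power2_eq_square algebra_simps)
    then show ?thesis using c(1) unfolding t_def s_def by blast
  qed
  \<comment> \<open>\<open>ip (T x) (S x)\<close> is the diagonal value of
    \<open>?S' \<circ> T\<close> at \<open>x\<close>, so norming vectors of that operator are
    norming for the pair \<open>T\<close>, \<open>S\<close>.\<close>
  have P2_P1: ?P1 if ?P2
  proof (cases "t = 0 \<or> s = 0")
    case False
    let ?U = "?S' \<circ> T"
    have t: "0 < t" "0 < s" using False ts by auto
    have U: "op_norm ?U = t * s" "A_spectral_radius A ?U = op_norm ?U"
      using \<open>?P2\<close> by (simp_all add: t_def s_def)
    have "0 < op_norm ?U" using U(1) t by simp
    then obtain c where c: "cmod c = 1"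
      "\<And>e. e > 0 \<Longrightarrow> \<exists>x. N x = 1 \<and> op_norm ?U - e \<le> Re (cnj c * ip (?U x) x)"
      using common_phase[OF S'Tb _ norming_vectors_of_spectral_radius[OF S'Tb U(2)]] by blast
    have "op_norm (?R c) = op_norm T + op_norm S"
    proof (rule parallel_of_norming_vectors[OF Tb Sb c(1)])
      show "0 < op_norm T" "0 < op_norm S" using t by (simp_all add: t_def s_def)
    qed (use c(2) U(1) in \<open>simp add: ip_A_sharp[OF S] t_def s_def\<close>)
    then show ?thesis using Tb Sb c(1) unfolding A_parallel_def by blast
  qed (rule zero)
  have P1_rest: "?P2 \<and> ?P3" if ?P1
  proof -
    obtain c where c: "cmod c = 1" "op_norm (?R c) = op_norm T + op_norm S"
      using \<open>?P1\<close> unfolding A_parallel_def by blast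
    have ex: "\<exists>x. N x = 1 \<and> t\<^sup>2 - e \<le> (N (T x))\<^sup>2 \<and> t * s - e \<le> Re (cnj c * ip (T x) (S x))"
      if "e > 0" for e
      unfolding t_def s_def by (rule norming_vector_of_parallel[OF Tb Sb c that])
    \<comment> \<open>Exchanging the operators conjugates the product: \<open>?S' \<circ> T\<close>
      is normed with the phase \<open>cnj c\<close>, \<open>?T' \<circ> S\<close> with
      \<open>c\<close>.\<close>
    have conj_eq: "Re (c * ip (S x) (T x)) = Re (cnj c * ip (T x) (S x))" for x
      using ip_commute[of "S x" "T x"] by simp
    have S'T: "op_norm (?S' \<circ> T) = t * s"
    proof (rule antisym)
      show "op_norm (?S' \<circ> T) \<le> t * s" using S'_le[OF Tb] by (simp add: t_def mult.commute)
      show "t * s \<le> op_norm (?S' \<circ> T)"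
        using c(1) ex by (intro op_norm_ge_of_norming_vectors[OF S'Tb, of "cnj c"])
          (auto simp: ip_A_sharp[OF S])
    qed
    have T'S: "op_norm (?T' \<circ> S) = t * s"
    proof (rule antisym)
      show "op_norm (?T' \<circ> S) \<le> t * s" using T'_le[OF Sb] by (simp add: s_def)
      show "t * s \<le> op_norm (?T' \<circ> S)"
        using ex by (intro op_norm_ge_of_norming_vectors[OF T'Sb c(1)])
          (auto simp only: ip_A_sharp[OF T] conj_eq o_apply)
    qed
    have "A_spectral_radius A (?S' \<circ> T) = op_norm (?S' \<circ> T)"
      using ex by (intro spectral_radius_of_norming_vectors[OF S'Tb c(1)])
        (auto simp: ip_A_sharp[OF S] S'T)
    then have P2: ?P2 using S'T T'S by (simp add: t_def s_def)
    have "op_norm (?T' \<circ> ?R c) = t\<^sup>2 + t * s"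
    proof (rule antisym)
      have "op_norm (?T' \<circ> ?R c) \<le> t * op_norm (?R c)" by (rule T'_le[OF Rb])
      also have "\<dots> \<le> t * (t + s)" using R_le[OF c(1)] ts(1) by (rule mult_left_mono)
      finally show "op_norm (?T' \<circ> ?R c) \<le> t\<^sup>2 + t * s"
        by (simp add: power2_eq_square algebra_simps)
      \<comment> \<open>Both estimates of \<open>ex\<close> hold at one vector, with tolerance
        \<open>e / 2\<close> each; the phase already sits in \<open>?R c\<close>, so the factor here
        is 1.\<close>
      show "t\<^sup>2 + t * s \<le> op_norm (?T' \<circ> ?R c)"
      proof (rule op_norm_ge_of_norming_vectors[OF T'Rb])
        show "cmod 1 = 1" by simp
        fix e :: real assume "e > 0"
        then obtain x where x: "N x = 1" "t\<^sup>2 - e / 2 \<le> (N (T x))\<^sup>2"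
          "t * s - e / 2 \<le> Re (cnj c * ip (T x) (S x))"
          using ex[of "e / 2"] by auto
        have "Re (1 * ip ((?T' \<circ> ?R c) x) x) = (N (T x))\<^sup>2 + Re (c * ip (S x) (T x))"
          by (simp add: ip_A_sharp[OF T] ip_simps N_square)
        then have "t\<^sup>2 + t * s - e \<le> Re (1 * ip ((?T' \<circ> ?R c) x) x)"
          using x unfolding conj_eq by linarith
        then show "\<exists>x. N x = 1 \<and> t\<^sup>2 + t * s - e \<le> Re (1 * ip ((?T' \<circ> ?R c) x) x)"
          using x(1) by blast
      qed
    qed
    then have "op_norm (\<lambda>x. (?T' \<circ> T) x + c *\<^sub>C (?T' \<circ> S) x) = op_norm (?T' \<circ> T) + op_norm (?T' \<circ> S)"
      unfolding T'R T'T T'S .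
    then have "A_parallel A (?T' \<circ> T) (?T' \<circ> S)"
      unfolding A_parallel_def using T'Tb T'Sb c(1) by blast
    then show ?thesis using P2 T'S by (simp add: t_def s_def)
  qed
  show ?thesis using P1_rest P2_P1 P3_P4 P4_P1 by blast
qed

end
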